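(* $(i)$ There exist a constant $y_0\in\left(\frac{\phi_0\lambda}{\lambda-1},\phi_0\right)$, an increasing function $\varphi:(0,y_0]\to(0,\phi_0]$, and a function $\psi:(0,y_0]\to(0,1)$ satisfying, for $0<y\le y_0$, the system $$\begin{cases}\varphi'(y)=\frac1y\varphi(y)\big(1-\psi(y)\big),\\[1ex]\psi'(y)=-\frac{2\rho\sigma^2}{\mu^2}\left[\frac{1-\psi(y)}{y}\left(\frac{\mu^2}{2\rho\sigma^2}\psi(y)-(U_+')^{-1}\big(\varphi(y)\big)+\frac{r-\delta}{\rho}+1-\alpha\right)-\frac{r+\rho}{\rho\,\varphi(y)}+\frac{\delta}{\rho y}\right],\end{cases}$$ with the free boundary conditions $$\varphi(y_0)=\phi_0,\qquad \psi(y_0)=\frac{2\sigma^2}{\phi_0\mu^2}\left(\frac{\delta}{\lambda}+r+\rho-\delta\right)(y_0-\phi_0).$$ Moreover, at least one of the following holds: $\lim_{y\to0+}\varphi(y)>0$ or $\lim_{y\to0+}\psi(y)=1$. $(ii)$ Given the solution $(\varphi,\psi,y_0)$ in part $(i)$, define $$u(y):=\frac1\delta\left[\frac{\mu^2}{2\rho\sigma^2}\varphi(y)\psi(y)+G\big(\varphi(y)\big)+\frac{\delta-r-\rho}{\rho}\big(y-\varphi(y)\big)\right],\quad 0<y\le y_0.$$ Then $(u,y_0)$ is a solution of the free-boundary problem $$\begin{cases}\frac{\mu^2}{2\sigma^2}y^2u''(y)+G\big(y-\rho yu'(y)\big)+(\delta-r-\rho)yu'(y)-\delta u(y)=0,\quad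 0<y\le y_0,\\[1ex] y_0-\rho y_0u'(y_0)=\phi_0,\\[1ex] u(y_0)=\frac{y_0-\phi_0}{\rho\lambda}+\frac{U(0)}{\delta}.\end{cases}$$ Furthermore, $$u'(y)=\frac{y-\varphi(y)}{\rho y},\qquad u''(y)=\frac{1}{\rho y^2}\varphi(y)\psi(y),\qquad 0<y<y_0,$$ $u$ is decreasing and convex on $(0,y_0)$, and $\lim_{y\to0+}u'(y)=-\infty$.
   Context: Constants: $r\ge0$ and $\mu,\sigma,\rho,\delta,\alpha>0$. Utility: $U_\pm\in\mathcal U:=\{f\in C^2(\mathbb R_+): f'>0,\ f''<0,\ f'(+\infty)=0,\ f(0)=0\}$; here values at $0$ are understood as right limits at $0$ and $f'(0):=f'(0^+)\in(0,+\infty]$ may be infinite. The S-shaped utility is $U(c)=U_+(c-\alpha)$ for $c>\alpha$ and $U(c)=-U_-(\alpha-c)$ for $0\le c\le\alpha$; in particular $U(0)=-U_-(\alpha)$. Standing assumptions: (A1) $U_-(\alpha)\le\alpha U_+'(0)$; (A2) there exist constants $a_1,a_2,a_3>0$ and $a_4\ge0$ such that $U_+(x)\le a_1+xU_+'(x)+a_2U_+'(x)^{-a_4}$ for all $x>a_3$. $c_0\ge\alpha$ is the unique solution of $c_0U_+'(c_0-\alpha)-U_+(c_0-\alpha)=U_-(\alpha)$, and $\phi_0:=U_+'(c_0-\alpha)$. $(U_+')^{-1}$ is the inverse function of $U_+'$, used on $(0,\phi_0]$, and $$G(\phi):=U_+\big((U_+')^{-1}(\phi)\big)-\phi\big(\alpha+(U_+')^{-1}(\phi)\big),\quad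 0<\phi\le\phi_0.$$ $$\lambda:=\frac{\sigma^2}{\mu^2}\left(\frac{\mu^2}{2\sigma^2}+r+\rho-\delta-\sqrt{\left(\frac{\mu^2}{2\sigma^2}+r+\rho-\delta\right)^2+2\delta\frac{\mu^2}{\sigma^2}}\right)<0.$$ Derivatives at the endpoint $y_0$ of $(0,y_0]$ are one-sided (left) derivatives. *)

theory Defs
  imports "HOL-Analysis.Analysis"
begin

text \<open>
  A utility function is a function on \<open>[0,\<infinity>)\<close>, represented by a function on all reals whose values
  at negative arguments are irrelevant.  It is twice continuously differentiable on the open
  half-line only, since the marginal utility at \<open>0\<close> may be infinite; its value at \<open>0\<close> is its right
  limit there.
\<close>

definition utility_class :: "(real \<Rightarrow> real) set" where
  "utility_class = {f.
     f differentiable_on {0<..} \<and> deriv f differentiable_on {0<..} \<and>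
     continuous_on {0<..} (deriv (deriv f)) \<and>
     (\<forall>x>0. deriv f x > 0) \<and> (\<forall>x>0. deriv (deriv f) x < 0) \<and>
     (deriv f \<longlongrightarrow> 0) at_top \<and>
     f 0 = 0 \<and> (f \<longlongrightarrow> f 0) (at_right 0)}"

text \<open>The marginal utility on \<open>[0,\<infinity>)\<close>; at \<open>0\<close> it is the right limit, possibly \<open>\<infinity>\<close>.\<close>

definition marginal :: "(real \<Rightarrow> real) \<Rightarrow> real \<Rightarrow> ereal" where
  "marginal f x = (if x = 0 then Lim (at_right 0) (\<lambda>t. ereal (deriv f t)) else ereal (deriv f x))"

definition S_utility :: "(real \<Rightarrow> real) \<Rightarrow> (real \<Rightarrow> real) \<Rightarrow> real \<Rightarrow> real \<Rightarrow> real" where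
  "S_utility Up Um \<alpha> c = (if c > \<alpha> then Up (c - \<alpha>) else - Um (\<alpha> - c))"

definition c_zero :: "(real \<Rightarrow> real) \<Rightarrow> (real \<Rightarrow> real) \<Rightarrow> real \<Rightarrow> real" where
  "c_zero Up Um \<alpha> =
     (THE c. c \<ge> \<alpha> \<and> ereal c * marginal Up (c - \<alpha>) - ereal (Up (c - \<alpha>)) = ereal (Um \<alpha>))"

definition phi_zero :: "(real \<Rightarrow> real) \<Rightarrow> (real \<Rightarrow> real) \<Rightarrow> real \<Rightarrow> real" where
  "phi_zero Up Um \<alpha> = real_of_ereal (marginal Up (c_zero Up Um \<alpha> - \<alpha>))"

text \<open>The inverse is taken over \<open>[0,\<infinity>)\<close>, so that it sends \<open>f'(0+)\<close> to \<open>0\<close> when that limit is finite.\<close>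

definition inv_marginal :: "(real \<Rightarrow> real) \<Rightarrow> real \<Rightarrow> real" where
  "inv_marginal f p = the_inv_into {0..} (marginal f) (ereal p)"

definition G_fun :: "(real \<Rightarrow> real) \<Rightarrow> real \<Rightarrow> real \<Rightarrow> real" where
  "G_fun Up \<alpha> p = Up (inv_marginal Up p) - p * (\<alpha> + inv_marginal Up p)"

definition lam :: "real \<Rightarrow> real \<Rightarrow> real \<Rightarrow> real \<Rightarrow> real \<Rightarrow> real" where
  "lam r \<mu> \<sigma> \<rho> \<delta> = \<sigma>\<^sup>2 / \<mu>\<^sup>2 *
     (\<mu>\<^sup>2 / (2 * \<sigma>\<^sup>2) + r + \<rho> - \<delta>
      - sqrt ((\<mu>\<^sup>2 / (2 * \<sigma>\<^sup>2) + r + \<rho> - \<delta>)\<^sup>2 + 2 * \<delta> * (\<mu>\<^sup>2 / \<sigma>\<^sup>2)))"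

text \<open>
  Functions on \<open>(0,y0]\<close> are represented by functions on all reals.  Derivatives are taken within
  \<open>(0,y0]\<close>: at interior points these are ordinary derivatives, at \<open>y0\<close> left derivatives.
\<close>

definition system_solution ::
  "real \<Rightarrow> real \<Rightarrow> real \<Rightarrow> real \<Rightarrow> real \<Rightarrow> real \<Rightarrow> (real \<Rightarrow> real) \<Rightarrow> (real \<Rightarrow> real) \<Rightarrow>
   real \<Rightarrow> (real \<Rightarrow> real) \<Rightarrow> (real \<Rightarrow> real) \<Rightarrow> bool" where
  "system_solution r \<mu> \<sigma> \<rho> \<delta> \<alpha> Up Um y0 \<phi> \<psi> \<longleftrightarrow>
     (let l = lam r \<mu> \<sigma> \<rho> \<delta>; \<phi>0 = phi_zero Up Um \<alpha> in
       y0 \<in> {\<phi>0 * l / (l - 1) <..< \<phi>0} \<and>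
       \<phi> \<in> {0<..y0} \<rightarrow> {0<..\<phi>0} \<and> strict_mono_on {0<..y0} \<phi> \<and>
       \<psi> \<in> {0<..y0} \<rightarrow> {0<..<1} \<and>
       (\<forall>y\<in>{0<..y0}.
          (\<phi> has_real_derivative 1 / y * \<phi> y * (1 - \<psi> y)) (at y within {0<..y0}) \<and>
          (\<psi> has_real_derivative
             - (2 * \<rho> * \<sigma>\<^sup>2 / \<mu>\<^sup>2) *
               ((1 - \<psi> y) / y *
                  (\<mu>\<^sup>2 / (2 * \<rho> * \<sigma>\<^sup>2) * \<psi> y - inv_marginal Up (\<phi> y) + (r - \<delta>) / \<rho> + 1 - \<alpha>)
                - (r + \<rho>) / (\<rho> * \<phi> y) + \<delta> / (\<rho> * y))) (at y within {0<..y0})) \<and>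
       \<phi> y0 = \<phi>0 \<and>
       \<psi> y0 = 2 * \<sigma>\<^sup>2 / (\<phi>0 * \<mu>\<^sup>2) * (\<delta> / l + r + \<rho> - \<delta>) * (y0 - \<phi>0))"

definition u_fun ::
  "real \<Rightarrow> real \<Rightarrow> real \<Rightarrow> real \<Rightarrow> real \<Rightarrow> real \<Rightarrow> (real \<Rightarrow> real) \<Rightarrow>
   (real \<Rightarrow> real) \<Rightarrow> (real \<Rightarrow> real) \<Rightarrow> real \<Rightarrow> real" where
  "u_fun r \<mu> \<sigma> \<rho> \<delta> \<alpha> Up \<phi> \<psi> y =
     1 / \<delta> * (\<mu>\<^sup>2 / (2 * \<rho> * \<sigma>\<^sup>2) * \<phi> y * \<psi> y + G_fun Up \<alpha> (\<phi> y) + (\<delta> - r - \<rho>) / \<rho> * (y - \<phi> y))"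

text \<open>Here \<open>u1\<close> and \<open>u2\<close> are the first and second derivatives of \<open>u\<close>, one-sided at \<open>y0\<close>.\<close>

definition free_boundary_solution ::
  "real \<Rightarrow> real \<Rightarrow> real \<Rightarrow> real \<Rightarrow> real \<Rightarrow> real \<Rightarrow> (real \<Rightarrow> real) \<Rightarrow> (real \<Rightarrow> real) \<Rightarrow>
   (real \<Rightarrow> real) \<Rightarrow> real \<Rightarrow> bool" where
  "free_boundary_solution r \<mu> \<sigma> \<rho> \<delta> \<alpha> Up Um u y0 \<longleftrightarrow>
     0 < y0 \<and>
     (\<exists>u1 u2.
       (\<forall>y\<in>{0<..y0}.
          (u has_real_derivative u1 y) (at y within {0<..y0}) \<and>
          (u1 has_real_derivative u2 y) (at y within {0<..y0}) \<and>
          \<mu>\<^sup>2 / (2 * \<sigma>\<^sup>2) * y\<^sup>2 * u2 y + G_fun Up \<alpha> (y - \<rho> * y * u1 y)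
            + (\<delta> - r - \<rho>) * y * u1 y - \<delta> * u y = 0 \<and>
          \<comment> \<open>\<open>G\<close> is defined on \<open>(0,\<phi>0]\<close> only\<close>
          y - \<rho> * y * u1 y \<in> {0<..phi_zero Up Um \<alpha>}) \<and>
       y0 - \<rho> * y0 * u1 y0 = phi_zero Up Um \<alpha> \<and>
       u y0 = (y0 - phi_zero Up Um \<alpha>) / (\<rho> * lam r \<mu> \<sigma> \<rho> \<delta>) + S_utility Up Um \<alpha> 0 / \<delta>)"

end

(* With k = mu^2 / (2 sigma^2), s = ln (y0 / y) and w = phi psi, the system becomes
     phi' = - phi + w,   k w' = (phi - w) (b - rho (alpha + I phi)) + delta phi - (r + rho) y0 exp (- s),
   where b = r + rho - delta and I is the inverse marginal utility.  Since G' = - (alpha + I), the quantity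
   V = k w + rho G phi - b (y - phi) satisfies V' = delta (phi - y0 exp (- s)); in the variables (phi, V) the
   right-hand side involves only the C^1 function G, so it is Lipschitz even if I is not, and the
   trajectories depend continuously on the shooting parameter y0.

   The trajectory must keep 0 < w < phi for ever.  It exits only transversally, because w = w' = 0
   forces k w'' = rho phi^2 I'(phi) < 0 and phi - w = (phi - w)' = 0 forces k (phi - w)'' = - (r + rho) y < 0.
   Hence the parameters for which it leaves through w = 0 and those for which it leaves through
   w = phi form disjoint open sets; they contain the endpoints phi0 and phi0 lambda / (lambda - 1)
   respectively, and by connectedness some y0 in between belongs to neither.

   If phi tends to 0, then I phi tends to infinity and would push psi below 0 unless psi tends to 1; since
   ln (phi / y) has derivative psi in s, phi / y is unbounded in either case, i.e. u' tends to - infinity. *)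

theory Submission
  imports Defs
begin

section \<open>Ordinary differential equations depending on a parameter\<close>

text \<open>The boundary data express a C^2 fit at \<open>y0\<close> with a function C y^\<Lambda> +
  U(0)/\<delta>: here \<Lambda> is the negative root of k \<Lambda> (\<Lambda> - 1) = (r + \<rho> -
  \<delta>) \<Lambda> + \<delta>, the characteristic equation of the linear part of the equation for
  u. The fit prescribes w = (1 - \<Lambda>)(\<phi>0 - y0) at s = 0, and the interval allowed for y0
  is exactly the one on which this lies strictly between 0 and \<phi>0. The obstacle sits at
  \<phi>0. If c0 = \<alpha>, then I \<phi>0 = 0, and I may have infinite slope there because U'' may
  vanish at 0+. So at the start of every trajectory I is known to be continuous only. This is why V
  replaces w for existence and dependence on the parameter, and why exits at s = 0 are checked by
  explicit values while those at s > 0 may use I'. The quantity V is also the value function in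
  disguise, V = \<rho> \<delta> u, so the identity for V' is the formula for u'. Part (ii) speaks of
  every solution; monotonicity and limits are therefore derived from the system alone, not from the
  shooting construction.\<close>

lemma continuous_on_integral_upper:
  fixes g :: "'a::topological_space \<Rightarrow> real \<Rightarrow> 'b::banach"
  assumes g: "continuous_on (A \<times> {0..S}) (\<lambda>(a, t). g a t)"
  shows "continuous_on (A \<times> {0..S}) (\<lambda>(a, s). integral {0..s} (g a))"
proof -
  \<comment> \<open>The substitution t = s \<theta> turns the variable upper limit into a factor, so
    the theorem on parameter integrals over a fixed interval applies. It degenerates at s = 0, where
    both sides vanish.\<close>
  have eq: "integral {0..s} (g a) = s *\<^sub>R integral {0..1} (\<lambda>\<theta>. g a (s * \<theta>))"
    if "a \<in> A" "s \<in> {0..S}" for a s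
  proof (cases "s = 0")
    case False
    with that have s: "s > 0" by auto
    have "continuous_on {0..s} (g a)"
      by (rule continuous_on_compose2[OF g, of _ "\<lambda>t. (a, t)", simplified])
        (use that in \<open>auto intro!: continuous_intros\<close>)
    then have "(g a has_integral integral {0..s} (g a)) (cbox 0 s)"
      by (simp add: integrable_continuous_real integrable_integral)
    from has_integral_affinity[OF this, of s 0] s
    have "((\<lambda>\<theta>. g a (s * \<theta>)) has_integral (1 / s) *\<^sub>R integral {0..s} (g a)) {0..1}"
      by (simp add: image_affinity_atLeastAtMost_div)
    then show ?thesis using s by (simp add: integral_unique)
  qed simp
  have "continuous_on (A \<times> {0..S}) (\<lambda>p. integral (cbox 0 1) (\<lambda>\<theta>. g (fst p) (snd p * \<theta>)))"
  proof (rule integral_continuous_on_param)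
    have "continuous_on ((A \<times> {0..S}) \<times> cbox 0 1)
            (\<lambda>x. (\<lambda>(a, t). g a t) (fst (fst x), snd (fst x) * snd x))"
      by (rule continuous_on_compose2[OF g])
        (auto intro!: continuous_intros mult_nonneg_nonneg intro: mult_left_le order_trans[OF mult_left_le])
    then show "continuous_on ((A \<times> {0..S}) \<times> cbox 0 1) (\<lambda>(p, \<theta>). g (fst p) (snd p * \<theta>))"
      by (simp add: case_prod_beta)
  qed
  then have "continuous_on (A \<times> {0..S})
     (\<lambda>p. snd p *\<^sub>R integral {0..1} (\<lambda>\<theta>. g (fst p) (snd p * \<theta>)))"
    by (auto intro!: continuous_intros)
  then show ?thesis
    by (rule continuous_on_eq) (auto simp: eq)
qed

text \<open>The Picard iterates are formed for all parameters at once, so joint continuity survives the uniform limit.\<close>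

lemma parametric_ode_solution:
  fixes f :: "'a::metric_space \<Rightarrow> real \<Rightarrow> 'b::banach \<Rightarrow> 'b"
  assumes A: "compact A" and x0: "continuous_on A x0"
    and f: "continuous_on (A \<times> {0..} \<times> UNIV) (\<lambda>(a, s, x). f a s x)"
    and lip: "\<And>S. \<exists>L. \<forall>a\<in>A. \<forall>s\<in>{0..S}. \<forall>x y. norm (f a s x - f a s y) \<le> L * norm (x - y)"
  obtains X where "\<And>S. continuous_on (A \<times> {0..S}) (\<lambda>(a, s). X a s)"
    and "\<And>a. a \<in> A \<Longrightarrow> X a 0 = x0 a"
    and "\<And>a s. a \<in> A \<Longrightarrow> s \<ge> 0 \<Longrightarrow> (X a has_vector_derivative f a s (X a s)) (at s within {0..})"
proof -
  define P where "P = rec_nat (\<lambda>a s. x0 a) (\<lambda>n Q a s. x0 a + integral {0..s} (\<lambda>t. f a t (Q a t)))"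
  have P0: "P 0 a s = x0 a" and PS: "P (Suc n) a s = x0 a + integral {0..s} (\<lambda>t. f a t (P n a t))" for n a s
    by (simp_all add: P_def)
  have fcomp: "continuous_on (A \<times> {0..S}) (\<lambda>(a, s). f a s (Q a s))"
    if "continuous_on (A \<times> {0..S}) (\<lambda>(a, s). Q a s)" for Q S
  proof -
    have "continuous_on (A \<times> {0..S}) (\<lambda>p. (\<lambda>(a, s, x). f a s x) (fst p, snd p, Q (fst p) (snd p)))"
      using that by (intro continuous_on_compose2[OF f]) (auto intro!: continuous_intros simp: case_prod_beta)
    then show ?thesis by (simp add: case_prod_beta)
  qed
  have x0': "continuous_on (A \<times> {0..S}) (\<lambda>(a, s). x0 a)" for S
    unfolding case_prod_beta by (rule continuous_on_compose2[OF x0]) (auto intro!: continuous_intros)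
  have step: "continuous_on (A \<times> {0..S}) (\<lambda>(a, s). x0 a + integral {0..s} (\<lambda>t. f a t (Q a t)))"
    if "continuous_on (A \<times> {0..S}) (\<lambda>(a, s). Q a s)" for Q S
    using continuous_on_add[OF x0' continuous_on_integral_upper[OF fcomp[OF that]]]
    by (simp add: case_prod_beta)
  have P: "continuous_on (A \<times> {0..S}) (\<lambda>(a, s). P n a s)" for n S
    by (induction n) (simp_all add: P0 PS x0' step)
  have slice: "continuous_on {0..s} (\<lambda>t. f a t (Q a t))"
    if "continuous_on (A \<times> {0..S}) (\<lambda>(a, s). Q a s)" "a \<in> A" "s \<le> S" for Q S a s
    using that by (intro continuous_on_compose2[OF fcomp[OF that(1)], of _ "\<lambda>t. (a, t)", simplified])
      (auto intro!: continuous_intros)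
  \<comment> \<open>Successive iterates differ by at most \<open>C 2\<^sup>-\<^sup>n exp (2 L s)\<close>, a bound reproduced by the integral operator.\<close>
  have lim: "\<exists>Y. uniform_limit (A \<times> {0..S}) (\<lambda>n (a, s). P n a s) (\<lambda>(a, s). Y a s) sequentially" for S
  proof -
    obtain L0 where L0: "norm (f a s x - f a s y) \<le> L0 * norm (x - y)"
      if "a \<in> A" "s \<in> {0..S}" for a s x y using lip by blast
    define L where "L = max L0 1"
    have L: "norm (f a s x - f a s y) \<le> L * norm (x - y)" if "a \<in> A" "s \<in> {0..S}" for a s x y
      using L0[OF that, of x y] mult_right_mono[of L0 L "norm (x - y)"] by (auto simp: L_def)
    have L1: "L \<ge> 1" by (simp add: L_def)
    have "compact ((\<lambda>(a, s). P (Suc 0) a s - P 0 a s) ` (A \<times> {0..S}))"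
      using continuous_on_diff[OF P P, of S "Suc 0" 0]
      by (intro compact_continuous_image compact_Times A) (auto simp: case_prod_beta)
    from compact_imp_bounded[OF this]
    obtain C where "\<forall>x\<in>(\<lambda>(a, s). P (Suc 0) a s - P 0 a s) ` (A \<times> {0..S}). norm x \<le> C"
      unfolding bounded_iff by blast
    then have C: "norm (P (Suc 0) a s - P 0 a s) \<le> C" if "a \<in> A" "s \<in> {0..S}" for a s
      using that by force
    have bd: "norm (P (Suc n) a s - P n a s) \<le> \<bar>C\<bar> * (1/2)^n * exp (2 * L * s)"
      if "a \<in> A" "s \<in> {0..S}" for n a s
      using that
    proof (induction n arbitrary: s)
      case 0
      have "norm (P (Suc 0) a s - P 0 a s) \<le> \<bar>C\<bar> * 1" using C[OF 0] by simp
      also have "\<dots> \<le> \<bar>C\<bar> * exp (2 * L * s)" using L1 0 by (intro mult_left_mono) auto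
      finally show ?case by simp
    next
      case (Suc n)
      have int: "(\<lambda>t. f a t (P m a t)) integrable_on {0..s}" for m
        using Suc.prems by (intro integrable_continuous_real slice[OF P]) auto
      \<comment> \<open>L exp (2 L t) has the primitive exp (2 L t) / 2: the weight trades the
        Lipschitz factor L for the geometric factor 1/2, whatever the size of L and of the
        horizon.\<close>
      let ?g = "\<lambda>t. L * (\<bar>C\<bar> * (1/2)^n * exp (2 * L * t))"
      have hi: "(?g has_integral
          (\<bar>C\<bar> * (1/2)^Suc n * exp (2 * L * s) - \<bar>C\<bar> * (1/2)^Suc n * exp (2 * L * 0))) {0..s}"
        using Suc.prems
        by (intro fundamental_theorem_of_calculus)
          (auto intro!: derivative_eq_intros simp flip: has_real_derivative_iff_has_vector_derivative)
      have "norm (f a t (P (Suc n) a t) - f a t (P n a t)) \<le> ?g t" if "t \<in> {0..s}" for t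
        using that Suc.prems L1
        by (intro order_trans[OF L] mult_left_mono Suc.IH) auto
      then have "norm (integral {0..s} (\<lambda>t. f a t (P (Suc n) a t) - f a t (P n a t))) \<le> integral {0..s} ?g"
        by (intro integral_norm_bound_integral integrable_diff int has_integral_integrable[OF hi])
      also have "\<dots> = \<bar>C\<bar> * (1/2)^Suc n * exp (2 * L * s) - \<bar>C\<bar> * (1/2)^Suc n"
        by (subst integral_unique[OF hi]) simp
      also have "\<dots> \<le> \<bar>C\<bar> * (1/2)^Suc n * exp (2 * L * s)" by simp
      finally have "norm (integral {0..s} (\<lambda>t. f a t (P (Suc n) a t) - f a t (P n a t)))
         \<le> \<bar>C\<bar> * (1/2)^Suc n * exp (2 * L * s)" .
      then show ?case
        by (simp only: PS[of "Suc n" a s] PS[of n a s] integral_diff[OF int int] add_diff_cancel_left)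
    qed
    define M where "M = (\<lambda>n. \<bar>C\<bar> * (1/2)^n * exp (2 * L * S))"
    have "uniform_limit (A \<times> {0..S}) (\<lambda>n p. \<Sum>i<n. P (Suc i) (fst p) (snd p) - P i (fst p) (snd p))
        (\<lambda>p. suminf (\<lambda>i. P (Suc i) (fst p) (snd p) - P i (fst p) (snd p))) sequentially"
    proof (rule Weierstrass_m_test)
      show "norm (P (Suc n) (fst p) (snd p) - P n (fst p) (snd p)) \<le> M n" if "p \<in> A \<times> {0..S}" for n p
        using that L1 unfolding M_def
        by (intro order_trans[OF bd] mult_left_mono) (auto simp: mem_Times_iff)
      show "summable M" unfolding M_def by (intro summable_mult2 summable_mult summable_geometric) auto
    qed
    then have "uniform_limit (A \<times> {0..S}) (\<lambda>n p. P 0 (fst p) (snd p) + (\<Sum>i<n. P (Suc i) (fst p) (snd p) - P i (fst p) (snd p)))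
        (\<lambda>p. P 0 (fst p) (snd p) + suminf (\<lambda>i. P (Suc i) (fst p) (snd p) - P i (fst p) (snd p))) sequentially"
      by (intro uniform_limit_intros)
    then show ?thesis
      by (intro exI[of _ "\<lambda>a s. P 0 a s + suminf (\<lambda>i. P (Suc i) a s - P i a s)"])
        (simp add: sum_lessThan_telescope[of "\<lambda>i. P i (fst p) (snd p)" for p] case_prod_unfold)
  qed
  \<comment> \<open>\<open>lim\<close> gives a limit for each horizon S separately; taking the
    pointwise limit yields one function serving all horizons.\<close>
  define X where "X = (\<lambda>a s. Lim sequentially (\<lambda>n. P n a s))"
  have ul: "uniform_limit (A \<times> {0..S}) (\<lambda>n (a, s). P n a s) (\<lambda>(a, s). X a s) sequentially" for S
  proof -
    obtain Y where Y: "uniform_limit (A \<times> {0..S}) (\<lambda>n (a, s). P n a s) (\<lambda>(a, s). Y a s) sequentially"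
      using lim by blast
    have "Y a s = X a s" if "a \<in> A" "s \<in> {0..S}" for a s
      using tendsto_uniform_limitI[OF Y, of "(a, s)"] that
      unfolding X_def by (auto intro!: tendsto_Lim[symmetric])
    then show ?thesis
      by (intro uniform_limit_cong'[THEN iffD1, OF _ _ Y]) auto
  qed
  have X: "continuous_on (A \<times> {0..S}) (\<lambda>(a, s). X a s)" for S
    by (rule uniform_limit_theorem[OF _ ul]) (auto simp: P)
  have eq: "X a s = x0 a + integral {0..s} (\<lambda>t. f a t (X a t))" if a: "a \<in> A" and s: "s \<ge> 0" for a s
  proof (rule LIMSEQ_unique)
    show "(\<lambda>n. P (Suc n) a s) \<longlonglongrightarrow> X a s"
      using tendsto_uniform_limitI[OF ul, of "(a, s)" s] a s by (intro LIMSEQ_Suc) auto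
    obtain L where L: "norm (f a' t x - f a' t y) \<le> L * norm (x - y)"
      if "a' \<in> A" "t \<in> {0..s}" for a' t x y using lip[of s] by blast
    have "uniform_limit {0..s} (\<lambda>n t. f a t (P n a t)) (\<lambda>t. f a t (X a t)) sequentially"
    proof (rule uniform_limitI)
      fix e :: real assume "e > 0"
      then have "\<forall>\<^sub>F n in sequentially. \<forall>p\<in>A \<times> {0..s}. dist (case p of (a, s) \<Rightarrow> P n a s) (case p of (a, s) \<Rightarrow> X a s) < e / (\<bar>L\<bar> + 1)"
        by (intro uniform_limitD[OF ul]) auto
      then show "\<forall>\<^sub>F n in sequentially. \<forall>t\<in>{0..s}. dist (f a t (P n a t)) (f a t (X a t)) < e"
      proof (rule eventually_mono, intro ballI)
        fix n t assume *: "\<forall>p\<in>A \<times> {0..s}. dist (case p of (a, s) \<Rightarrow> P n a s) (case p of (a, s) \<Rightarrow> X a s) < e / (\<bar>L\<bar> + 1)"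
          and t: "t \<in> {0..s}"
        have "dist (P n a t) (X a t) < e / (\<bar>L\<bar> + 1)" using *[rule_format, of "(a, t)"] a t by simp
        then have "dist (P n a t) (X a t) * (\<bar>L\<bar> + 1) < e" by (simp add: pos_less_divide_eq)
        moreover have "dist (f a t (P n a t)) (f a t (X a t)) \<le> (\<bar>L\<bar> + 1) * dist (P n a t) (X a t)"
          unfolding dist_norm using a t by (intro order_trans[OF L] mult_right_mono) auto
        ultimately show "dist (f a t (P n a t)) (f a t (X a t)) < e" by (simp add: mult.commute)
      qed
    qed
    moreover have "continuous_on {0..s} (\<lambda>t. f a t (P n a t))" for n
      using slice[OF P a, of s s] by simp
    ultimately obtain K J where K: "\<And>n. ((\<lambda>t. f a t (P n a t)) has_integral K n) {0..s}"
        and J: "((\<lambda>t. f a t (X a t)) has_integral J) {0..s}" and KJ: "K \<longlonglongrightarrow> J"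
      by (rule uniform_limit_integral) auto
    have "(\<lambda>n. integral {0..s} (\<lambda>t. f a t (P n a t))) \<longlonglongrightarrow> integral {0..s} (\<lambda>t. f a t (X a t))"
      unfolding integral_unique[OF K] integral_unique[OF J] by (rule KJ)
    then show "(\<lambda>n. P (Suc n) a s) \<longlonglongrightarrow> x0 a + integral {0..s} (\<lambda>t. f a t (X a t))"
      unfolding PS by (intro tendsto_intros)
  qed
  show thesis
  proof
    show "continuous_on (A \<times> {0..S}) (\<lambda>(a, s). X a s)" for S by (rule X)
    show "X a 0 = x0 a" if "a \<in> A" for a using eq[OF that, of 0] by simp
    show "(X a has_vector_derivative f a s (X a s)) (at s within {0..})" if a: "a \<in> A" and s: "s \<ge> 0" for a s
    proof -
      \<comment> \<open>The horizon s + 1 keeps s off the right end, so this derivative agrees with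
        the one within \<open>{0..}\<close>.\<close>
      have "((\<lambda>u. integral {0..u} (\<lambda>t. f a t (X a t))) has_vector_derivative f a s (X a s)) (at s within {0..s+1})"
        using s by (intro integral_has_vector_derivative slice[OF X a]) auto
      then have "((\<lambda>u. x0 a + integral {0..u} (\<lambda>t. f a t (X a t))) has_vector_derivative f a s (X a s)) (at s within {0..s+1})"
        by (auto intro!: derivative_eq_intros)
      then have "(X a has_vector_derivative f a s (X a s)) (at s within {0..s+1})"
        by (rule has_vector_derivative_transform[rotated 2]) (use s eq[OF a] in auto)
      moreover have "at s within {0..s+1} = at s within {0..}"
        by (rule at_within_nhd[of _ "{..<s+1}"]) auto
      ultimately show ?thesis by simp
    qed
  qed
qed

section \<open>Marginal utility and its inverse\<close>

locale utility =
  fixes U :: "real \<Rightarrow> real"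
  assumes utility: "U \<in> utility_class"
begin

abbreviation "I \<equiv> inv_marginal U"

lemma deriv_U: "x > 0 \<Longrightarrow> (U has_real_derivative deriv U x) (at x)"
  using utility unfolding utility_class_def differentiable_on_def
  by (auto simp: at_within_open[of _ "{0<..}"] DERIV_deriv_iff_real_differentiable)

lemma deriv2_U: "x > 0 \<Longrightarrow> (deriv U has_real_derivative deriv (deriv U) x) (at x)"
  using utility unfolding utility_class_def differentiable_on_def
  by (auto simp: at_within_open[of _ "{0<..}"] DERIV_deriv_iff_real_differentiable)

lemma deriv_U_pos: "x > 0 \<Longrightarrow> deriv U x > 0"
  and deriv2_U_neg: "x > 0 \<Longrightarrow> deriv (deriv U) x < 0"
  and deriv_U_at_top: "(deriv U \<longlongrightarrow> 0) at_top"
  and U_0: "U 0 = 0"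
  and U_at_0: "(U \<longlongrightarrow> 0) (at_right 0)"
  using utility unfolding utility_class_def by auto

lemma deriv_U_less:
  assumes "0 < x" "x < y"
  shows "deriv U y < deriv U x"
proof (rule DERIV_neg_imp_decreasing[OF assms(2)])
  show "\<exists>D. (deriv U has_real_derivative D) (at t) \<and> D < 0" if "x \<le> t" for t
    using deriv2_U[of t] deriv2_U_neg[of t] that assms(1) by (intro exI conjI) auto
qed

lemma continuous_on_U: "continuous_on {0..} U"
proof -
  have "continuous (at x within {0..}) U" if "x \<ge> 0" for x
  proof (cases "x = 0")
    case True
    then show ?thesis using U_at_0 by (simp add: continuous_within U_0 at_within_Ici_at_right)
  next
    case False
    then show ?thesis using that DERIV_isCont[OF deriv_U, of x] continuous_at_imp_continuous_at_within by auto
  qed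
  then show ?thesis by (auto simp: continuous_on_eq_continuous_within)
qed

lemma U_pos:
  assumes "x > 0"
  shows "U x > 0"
proof -
  have "U 0 < U x"
  proof (rule DERIV_pos_imp_increasing_open[OF assms])
    show "\<exists>D. (U has_real_derivative D) (at t) \<and> D > 0" if "0 < t" for t
      using deriv_U[OF that] deriv_U_pos[OF that] by blast
    show "continuous_on {0..x} U" by (rule continuous_on_subset[OF continuous_on_U]) auto
  qed
  then show ?thesis by (simp add: U_0)
qed

lemma marginal_pos: "x > 0 \<Longrightarrow> marginal U x = ereal (deriv U x)"
  by (simp add: marginal_def)

text \<open>Since \<open>deriv U\<close> decreases, its right limit at 0 exists in the extended
  reals as a supremum; this is what gives the \<open>Lim\<close> in \<open>marginal\<close> its
  intended value.\<close>

lemma marginal_0_SUP: "marginal U 0 = (SUP x\<in>{0<..}. ereal (deriv U x))"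
  and tendsto_marginal_0: "((\<lambda>t. ereal (deriv U t)) \<longlongrightarrow> marginal U 0) (at_right 0)"
proof -
  let ?L = "SUP x\<in>{0<..}. ereal (deriv U x)"
  have *: "((\<lambda>t. ereal (deriv U t)) \<longlongrightarrow> ?L) (at_right 0)"
  proof (rule order_tendstoI)
    fix a assume "a < ?L"
    then obtain x where x: "x > 0" "a < ereal (deriv U x)" by (auto simp: less_SUP_iff)
    then have "a < ereal (deriv U t)" if "t \<in> {0<..<x}" for t
      using deriv_U_less[of t x] that by (intro less_trans[OF x(2)]) auto
    then show "\<forall>\<^sub>F t in at_right 0. a < ereal (deriv U t)"
      using x by (intro eventually_at_rightI[of 0 x]) auto
  next
    fix a assume "?L < a"
    then have "ereal (deriv U t) < a" if "t \<in> {0<..<1}" for t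
      using that by (intro le_less_trans[OF SUP_upper[of t "{0<..}" "\<lambda>x. ereal (deriv U x)"] \<open>?L < a\<close>]) auto
    then show "\<forall>\<^sub>F t in at_right 0. ereal (deriv U t) < a"
      by (intro eventually_at_rightI[of 0 1]) auto
  qed
  then have "Lim (at_right 0) (\<lambda>t. ereal (deriv U t)) = ?L"
    by (intro tendsto_Lim) auto
  then show "marginal U 0 = ?L"
    by (simp add: marginal_def)
  with * show "((\<lambda>t. ereal (deriv U t)) \<longlongrightarrow> marginal U 0) (at_right 0)" by simp
qed

lemma marginal_less: "0 \<le> x \<Longrightarrow> x < y \<Longrightarrow> marginal U y < marginal U x"
proof (cases "x = 0")
  case True
  assume "x < y"
  then have "ereal (deriv U y) < ereal (deriv U (y / 2))"
    using True deriv_U_less[of "y / 2" y] by simp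
  also have "\<dots> \<le> marginal U 0"
    unfolding marginal_0_SUP using True \<open>x < y\<close> by (intro SUP_upper) auto
  finally show ?thesis using True \<open>x < y\<close> by (simp add: marginal_pos)
qed (auto simp: marginal_pos deriv_U_less)

lemma marginal_gt_0: "x \<ge> 0 \<Longrightarrow> marginal U x > 0"
proof -
  assume "x \<ge> 0"
  then have "ereal (deriv U (x + 1)) < marginal U x"
    using marginal_less[of x "x + 1"] by (simp add: marginal_pos)
  moreover have "0 < ereal (deriv U (x + 1))" using deriv_U_pos[of "x + 1"] \<open>x \<ge> 0\<close> by simp
  ultimately show ?thesis by (rule less_trans[rotated])
qed

lemma marginal_less_iff: "0 \<le> x \<Longrightarrow> 0 \<le> y \<Longrightarrow> marginal U y < marginal U x \<longleftrightarrow> x < y"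
  using marginal_less[of x y] marginal_less[of y x] by (cases x y rule: linorder_cases) auto

lemma inj_marginal: "inj_on (marginal U) {0..}"
proof (rule inj_onI)
  fix x y assume "x \<in> {0..}" "y \<in> {0..}" "marginal U x = marginal U y"
  then show "x = y"
    using marginal_less[of x y] marginal_less[of y x] by (cases x y rule: linorder_cases) auto
qed

lemma I_eqI: "x \<ge> 0 \<Longrightarrow> marginal U x = ereal p \<Longrightarrow> I p = x"
  unfolding inv_marginal_def by (rule the_inv_into_f_eq[OF inj_marginal]) auto

text \<open>Intermediate values of \<open>deriv U\<close>. For x = 0 the left end is first moved
  into the open half-line, since the marginal at 0 may be infinite; the right end comes from U'
  tending to 0.\<close>

lemma ex_marginal:
  assumes x: "x \<ge> 0" and p: "p > 0" "ereal p \<le> marginal U x"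
  shows "\<exists>z\<ge>x. marginal U z = ereal p"
proof (cases "marginal U x = ereal p")
  case False
  then have less: "ereal p < marginal U x" using p by auto
  obtain y where y: "y > 0" "y \<ge> x" "p \<le> deriv U y"
  proof (cases "x = 0")
    case True
    then obtain y where "y > 0" "ereal p < ereal (deriv U y)"
      using less unfolding True marginal_0_SUP less_SUP_iff by auto
    then show ?thesis using that True by auto
  next
    case False
    then show ?thesis using that[of x] x less by (simp add: marginal_pos)
  qed
  obtain w where w: "w \<ge> y" "deriv U w < p"
    using eventually_happens'[OF _ eventually_conj[OF eventually_ge_at_top[of y] order_tendstoD(2)[OF deriv_U_at_top p(1)]]]
    by auto
  have "continuous_on {y..w} (deriv U)"
    using y by (intro continuous_at_imp_continuous_on) (auto intro!: DERIV_isCont[OF deriv2_U])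
  then obtain z where "z \<ge> y" "deriv U z = p"
    using IVT2'[of "deriv U" w p y] y w by auto
  then show ?thesis using y by (intro exI[of _ z]) (auto simp: marginal_pos)
qed (auto intro: exI[of _ x])

text \<open>Concavity in a form that admits x = 0, where U has only a one-sided slope: the mean
  value theorem compares a chord with the strictly decreasing marginal. The hypothesis on p says
  that the slope at x is finite.\<close>

lemma U_le_tangent:
  assumes x: "x \<ge> 0" and z: "z \<ge> 0" and p: "marginal U x = ereal p"
  shows "U z \<le> U x + p * (z - x)"
proof -
  have mvt: "\<exists>\<xi>>s. \<xi> < t \<and> U t - U s = (t - s) * deriv U \<xi>" if st: "0 \<le> s" "s < t" for s t
  proof -
    have "continuous_on {s..t} U" using st by (intro continuous_on_subset[OF continuous_on_U]) auto
    moreover have "(U has_derivative (*) (deriv U \<xi>)) (at \<xi>)" if "s < \<xi>" for \<xi>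
      using deriv_U[of \<xi>] that st by (simp add: has_field_derivative_def)
    ultimately obtain \<xi> where "s < \<xi>" "\<xi> < t" "U t - U s = deriv U \<xi> * (t - s)"
      using mvt[of s t U "\<lambda>\<xi>. (*) (deriv U \<xi>)"] st by metis
    then show ?thesis by (auto simp: mult.commute)
  qed
  consider "x < z" | "x = z" | "z < x" by linarith
  then show ?thesis
  proof cases
    case 1
    from mvt[OF x 1] obtain \<xi> where \<xi>: "x < \<xi>" "U z - U x = (z - x) * deriv U \<xi>" by auto
    have "deriv U \<xi> < p" using marginal_less[OF x \<xi>(1)] p \<xi>(1) x by (simp add: marginal_pos)
    then have "(z - x) * deriv U \<xi> \<le> (z - x) * p" using 1 by (intro mult_left_mono) auto
    then show ?thesis using \<xi> by (simp add: mult.commute)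
  next
    case 3
    from mvt[OF z 3] obtain \<xi> where \<xi>: "z < \<xi>" "\<xi> < x" "U x - U z = (x - z) * deriv U \<xi>" by auto
    have "p < deriv U \<xi>" using marginal_less[of \<xi> x] p \<xi> z by (simp add: marginal_pos)
    then have "(x - z) * p \<le> (x - z) * deriv U \<xi>" using 3 by (intro mult_left_mono) auto
    then show ?thesis using \<xi> by (simp add: algebra_simps)
  qed simp
qed

text \<open>c U'(c - \<alpha>) - U(c - \<alpha>) is strictly decreasing: passing from slope q to the
  smaller q' lowers d q strictly as d > 0, and the tangent at d' - \<alpha> bounds the rest.
  Tangents, unlike derivatives of this expression, also cover d = \<alpha>.\<close>

lemma c_zero_unique:
  assumes "\<alpha> > 0" "c \<ge> \<alpha>" "c' \<ge> \<alpha>"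
    and p: "marginal U (c - \<alpha>) = ereal p" "c * p - U (c - \<alpha>) = m"
    and p': "marginal U (c' - \<alpha>) = ereal p'" "c' * p' - U (c' - \<alpha>) = m"
  shows "c = c'"
proof -
  have *: "\<not> d < d'" if d: "d \<ge> \<alpha>" "marginal U (d - \<alpha>) = ereal q" "d * q - U (d - \<alpha>) = m"
    and d': "d' \<ge> \<alpha>" "marginal U (d' - \<alpha>) = ereal q'" "d' * q' - U (d' - \<alpha>) = m" for d d' q q'
  proof
    assume "d < d'"
    then have "q' < q" using marginal_less[of "d - \<alpha>" "d' - \<alpha>"] d(1,2) d'(2) by simp
    then have "d * q' < d * q" using d(1) \<open>\<alpha> > 0\<close> by simp
    moreover have "U (d - \<alpha>) \<le> U (d' - \<alpha>) + q' * (d - d')"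
      using U_le_tangent[of "d' - \<alpha>" "d - \<alpha>" q'] d(1) d'(1,2) by simp
    ultimately show False using d(3) d'(3) by (simp add: algebra_simps)
  qed
  show ?thesis using *[of c p c' p'] *[of c' p' c p] assms by linarith
qed

text \<open>Equality in the hypothesis gives c = \<alpha>. Otherwise a real K strictly between m /
  \<alpha> and the marginal at 0 makes g exceed m near 0, where \<alpha> U' > \<alpha> K and U is
  small; g is below m far out, so intermediate values apply away from 0.\<close>

lemma c_zero_exists:
  assumes \<alpha>: "\<alpha> > 0" and m: "m > 0" and A1: "ereal m \<le> ereal \<alpha> * marginal U 0"
  shows "\<exists>c\<ge>\<alpha>. \<exists>p. marginal U (c - \<alpha>) = ereal p \<and> c * p - U (c - \<alpha>) = m"
proof (cases "marginal U 0 = ereal (m / \<alpha>)")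
  case True
  then show ?thesis using \<alpha> by (intro exI[of _ \<alpha>]) (auto simp: U_0)
next
  case False
  have "ereal (m / \<alpha>) \<le> marginal U 0"
    using A1 \<alpha> by (cases "marginal U 0") (auto simp: field_simps)
  with False have "ereal (m / \<alpha>) < marginal U 0" by auto
  from ereal_dense2[OF this] obtain K where "ereal (m / \<alpha>) < ereal K" and K2: "ereal K < marginal U 0"
    by blast
  then have K: "m / \<alpha> < K" by simp
  have "\<forall>\<^sub>F x in at_right 0. ereal K < ereal (deriv U x)"
    by (rule order_tendstoD(1)[OF tendsto_marginal_0 K2])
  moreover have "\<forall>\<^sub>F x in at_right 0. U x < \<alpha> * K - m"
    using K \<alpha> by (intro order_tendstoD(2)[OF U_at_0]) (simp add: field_simps)
  moreover have "\<forall>\<^sub>F x in at_right 0. (0::real) < x" by (simp add: eventually_at_right_less)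
  ultimately have "\<forall>\<^sub>F x in at_right 0. 0 < x \<and> K < deriv U x \<and> U x < \<alpha> * K - m"
    by eventually_elim auto
  from eventually_happens'[OF trivial_limit_at_right_real this]
  obtain x where x: "0 < x" "K < deriv U x" "U x < \<alpha> * K - m" by blast
  define g where "g = (\<lambda>x. (x + \<alpha>) * deriv U x - U x)"
  have "\<alpha> * K \<le> \<alpha> * deriv U x" using x \<alpha> by simp
  moreover have "x * deriv U x > 0" using x deriv_U_pos[of x] by simp
  ultimately have gx: "g x > m" using x unfolding g_def by (simp add: distrib_right)
  have "m / \<alpha> > 0" using m \<alpha> by simp
  then obtain y where y: "y \<ge> x" "deriv U y < m / \<alpha>"
    using eventually_happens'[OF _ eventually_conj[OF eventually_ge_at_top[of x] order_tendstoD(2)[OF deriv_U_at_top]]]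
    by auto
  \<comment> \<open>Concavity and U 0 = 0 give y U'(y) \<le> U y, hence g y \<le> \<alpha>
    U'(y).\<close>
  have "U 0 \<le> U y + deriv U y * (0 - y)"
    using y x by (intro U_le_tangent) (auto simp: marginal_pos)
  moreover have "\<alpha> * deriv U y < m" using y \<alpha> by (simp add: field_simps)
  ultimately have gy: "g y < m" unfolding g_def by (simp add: U_0 algebra_simps)
  have "isCont g z" if "z \<ge> x" for z
    unfolding g_def using DERIV_isCont[OF deriv_U, of z] DERIV_isCont[OF deriv2_U, of z] that x
    by (intro continuous_intros) auto
  then have "\<exists>z\<ge>x. z \<le> y \<and> g z = m"
    using gx gy y by (intro IVT2) auto
  then obtain z where "z \<ge> x" "g z = m" by auto
  then show ?thesis using x
    by (intro exI[of _ "z + \<alpha>"]) (auto simp: g_def marginal_pos)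
qed

end

section \<open>The threshold \<phi>0 and the inverse marginal utility on (0, \<phi>0]\<close>

locale utility_pair = utility U for U :: "real \<Rightarrow> real" +
  fixes Um :: "real \<Rightarrow> real" and \<alpha> :: real
  assumes \<alpha>: "\<alpha> > 0" and Um: "Um \<alpha> > 0" and A1: "ereal (Um \<alpha>) \<le> ereal \<alpha> * marginal U 0"
begin

lemma c_zero:
  shows "c_zero U Um \<alpha> \<ge> \<alpha>"
    and "marginal U (c_zero U Um \<alpha> - \<alpha>) = ereal (phi_zero U Um \<alpha>)"
    and "c_zero U Um \<alpha> * phi_zero U Um \<alpha> - U (c_zero U Um \<alpha> - \<alpha>) = Um \<alpha>"
proof -
  \<comment> \<open>An infinite marginal cannot satisfy the extended-real equation, because c > 0
    and the right-hand side is finite; the definite description therefore ranges over real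
    solutions.\<close>
  have iff: "ereal c * marginal U (c - \<alpha>) - ereal (U (c - \<alpha>)) = ereal (Um \<alpha>) \<longleftrightarrow>
      (\<exists>p. marginal U (c - \<alpha>) = ereal p \<and> c * p - U (c - \<alpha>) = Um \<alpha>)" if "c \<ge> \<alpha>" for c
    using that \<alpha> marginal_gt_0[of "c - \<alpha>"] by (cases "marginal U (c - \<alpha>)") auto
  obtain c p where c: "c \<ge> \<alpha>" "marginal U (c - \<alpha>) = ereal p" "c * p - U (c - \<alpha>) = Um \<alpha>"
    using c_zero_exists[OF \<alpha> Um A1] by blast
  have "c_zero U Um \<alpha> = c"
    unfolding c_zero_def
  proof (rule the_equality)
    show "c \<ge> \<alpha> \<and> ereal c * marginal U (c - \<alpha>) - ereal (U (c - \<alpha>)) = ereal (Um \<alpha>)"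
      using c iff[OF c(1)] by blast
    show "d = c" if "d \<ge> \<alpha> \<and> ereal d * marginal U (d - \<alpha>) - ereal (U (d - \<alpha>)) = ereal (Um \<alpha>)" for d
      using c that iff[of d] c_zero_unique[OF \<alpha>] by blast
  qed
  then show "c_zero U Um \<alpha> \<ge> \<alpha>" "marginal U (c_zero U Um \<alpha> - \<alpha>) = ereal (phi_zero U Um \<alpha>)"
    "c_zero U Um \<alpha> * phi_zero U Um \<alpha> - U (c_zero U Um \<alpha> - \<alpha>) = Um \<alpha>"
    using c by (simp_all add: phi_zero_def)
qed

abbreviation "\<phi>0 \<equiv> phi_zero U Um \<alpha>"

lemma phi_zero_pos: "\<phi>0 > 0"
  using marginal_gt_0[of "c_zero U Um \<alpha> - \<alpha>"] c_zero by simp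

lemma marginal_I:
  assumes "p \<in> {0<..\<phi>0}"
  shows "I p \<ge> 0" "marginal U (I p) = ereal p"
proof -
  obtain z where z: "z \<ge> c_zero U Um \<alpha> - \<alpha>" "marginal U z = ereal p"
    using ex_marginal[of "c_zero U Um \<alpha> - \<alpha>" p] assms c_zero by auto
  then have "z \<ge> 0" using c_zero(1) by simp
  then show "I p \<ge> 0" "marginal U (I p) = ereal p" using I_eqI z by auto
qed

lemma less_I_iff: "p \<in> {0<..\<phi>0} \<Longrightarrow> x \<ge> 0 \<Longrightarrow> x < I p \<longleftrightarrow> ereal p < marginal U x"
  using marginal_I[of p] marginal_less_iff[of x "I p"] by simp

lemma I_less_iff: "p \<in> {0<..\<phi>0} \<Longrightarrow> x \<ge> 0 \<Longrightarrow> I p < x \<longleftrightarrow> marginal U x < ereal p"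
  using marginal_I[of p] marginal_less_iff[of "I p" x] by simp

text \<open>I reverses the order, so bounds on I q are bounds on q via \<open>less_I_iff\<close> and
  \<open>I_less_iff\<close>. This argument includes p = \<phi>0, where I may be 0 and
  differentiability of the inverse may fail.\<close>

lemma continuous_on_I: "continuous_on {0<..\<phi>0} I"
  unfolding continuous_on_def
proof
  fix p assume p: "p \<in> {0<..\<phi>0}"
  have lim: "((\<lambda>q. ereal q) \<longlongrightarrow> ereal p) (at p within {0<..\<phi>0})" by (intro tendsto_intros)
  have mem: "\<forall>\<^sub>F q in at p within {0<..\<phi>0}. q \<in> {0<..\<phi>0}" by (simp add: eventually_at_filter)
  show "(I \<longlongrightarrow> I p) (at p within {0<..\<phi>0})"
  proof (rule order_tendstoI)
    fix a assume a: "a < I p"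
    show "\<forall>\<^sub>F q in at p within {0<..\<phi>0}. a < I q"
    proof (cases "a \<ge> 0")
      case True
      then have "\<forall>\<^sub>F q in at p within {0<..\<phi>0}. ereal q < marginal U a"
        using a p by (intro order_tendstoD(2)[OF lim]) (simp add: less_I_iff)
      with mem show ?thesis by eventually_elim (simp add: less_I_iff True)
    next
      case False
      show ?thesis using mem by eventually_elim (use marginal_I(1) False in force)
    qed
  next
    fix a assume a: "I p < a"
    then have a0: "a \<ge> 0" using marginal_I(1)[OF p] by simp
    have "\<forall>\<^sub>F q in at p within {0<..\<phi>0}. marginal U a < ereal q"
      using a p a0 by (intro order_tendstoD(1)[OF lim]) (simp add: I_less_iff)
    with mem show "\<forall>\<^sub>F q in at p within {0<..\<phi>0}. I q < a"
      by eventually_elim (simp add: I_less_iff a0)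
  qed
qed

text \<open>p < \<phi>0 forces I p > c0 - \<alpha> \<ge> 0, where \<open>deriv U\<close> is
  differentiable with nonzero derivative; at \<phi>0 the value c0 - \<alpha> may be 0.\<close>

lemma deriv_I:
  assumes p: "p \<in> {0<..<\<phi>0}"
  shows "\<exists>d<0. (I has_real_derivative d) (at p)"
proof (intro exI conjI)
  have pos: "I q > 0" if "q \<in> {0<..<\<phi>0}" for q
  proof -
    have "ereal q < marginal U (c_zero U Um \<alpha> - \<alpha>)" using that c_zero by simp
    then have "c_zero U Um \<alpha> - \<alpha> < I q" using that c_zero by (subst less_I_iff) auto
    then show ?thesis using c_zero by simp
  qed
  have "isCont I p"
    using continuous_on_subset[OF continuous_on_I, of "{0<..<\<phi>0}"] p
    by (auto simp: continuous_on_eq_continuous_at subset_eq)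
  moreover have "deriv U (I q) = q" if "0 < q" "q < \<phi>0" for q
    using that marginal_I(2)[of q] pos[of q] by (simp add: marginal_pos)
  ultimately show "(I has_real_derivative inverse (deriv (deriv U) (I p))) (at p)"
    using p pos[OF p] by (intro DERIV_inverse_function[where f = "deriv U" and a = 0 and b = \<phi>0] deriv2_U)
      (auto simp: less_imp_neq[OF deriv2_U_neg])
  show "inverse (deriv (deriv U) (I p)) < 0" using deriv2_U_neg[OF pos[OF p]] by simp
qed

lemma I_at_0: "filterlim I at_top (at_right 0)"
  unfolding filterlim_at_top_gt[of _ _ 0]
proof (intro allI impI)
  fix Z :: real assume Z: "Z > 0"
  have "Z \<le> I p" if "p \<in> {0<..<min \<phi>0 (deriv U Z)}" for p
    using that Z less_I_iff[of p Z] by (auto simp: marginal_pos)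
  then show "\<forall>\<^sub>F p in at_right 0. Z \<le> I p"
    using phi_zero_pos deriv_U_pos[OF Z] by (intro eventually_at_rightI[of 0 "min \<phi>0 (deriv U Z)"]) auto
qed

text \<open>Apart from the term - \<alpha> p, G is the convex conjugate, the supremum over x \<ge> 0
  of U x - p x, attained at I p; hence - (\<alpha> + I p) is a subgradient. No differentiability
  enters, so \<phi>0 is included.\<close>

lemma G_fun_subgradient:
  assumes p: "p \<in> {0<..\<phi>0}" and q: "q \<in> {0<..\<phi>0}"
  shows "G_fun U \<alpha> p - (\<alpha> + I p) * (q - p) \<le> G_fun U \<alpha> q"
  using U_le_tangent[OF marginal_I(1)[OF q] marginal_I(1)[OF p] marginal_I(2)[OF q]]
  unfolding G_fun_def by (simp add: algebra_simps)

text \<open>The equation defining c0 in terms of G; it puts U(0) into the boundary value of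
  u.\<close>

lemma G_fun_phi_zero: "G_fun U \<alpha> \<phi>0 = - Um \<alpha>"
proof -
  have "I \<phi>0 = c_zero U Um \<alpha> - \<alpha>" using c_zero by (intro I_eqI) auto
  then show ?thesis using c_zero(3) by (simp add: G_fun_def mult.commute)
qed

end

section \<open>Shooting for the free boundary\<close>

text \<open>The subgradient inequalities at p and at q enclose the difference quotient between j p
  and j q, and j is continuous at p. This differentiates G without differentiating I.\<close>

lemma real_derivative_of_subgradient:
  fixes f j :: "real \<Rightarrow> real"
  assumes S: "open S" "p \<in> S" and j: "isCont j p"
    and sub: "\<And>p q. p \<in> S \<Longrightarrow> q \<in> S \<Longrightarrow> f p + j p * (q - p) \<le> f q"
  shows "(f has_real_derivative j p) (at p)"
proof -
  have bd: "\<bar>(f q - f p) / (q - p) - j p\<bar> \<le> \<bar>j q - j p\<bar>" if q: "q \<in> S" "q \<noteq> p" for q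
  proof -
    have "j p * (q - p) \<le> f q - f p" "f q - f p \<le> j q * (q - p)"
      using sub[of p q] sub[of q p] q S by (simp_all add: algebra_simps)
    then have "\<bar>(f q - f p) - j p * (q - p)\<bar> \<le> \<bar>(j q - j p) * (q - p)\<bar>"
      by (simp add: algebra_simps)
    moreover have "(f q - f p) / (q - p) - j p = ((f q - f p) - j p * (q - p)) / (q - p)"
      using q by (simp add: field_simps)
    ultimately show ?thesis using q by (simp add: abs_mult pos_divide_le_eq)
  qed
  have "((\<lambda>q. (f q - f p) / (q - p) - j p) \<longlongrightarrow> 0) (at p)"
  proof (rule Lim_null_comparison)
    have "\<forall>\<^sub>F q in at p. q \<in> S" using S by (rule eventually_at_in_open')
    moreover have "\<forall>\<^sub>F q in at p. q \<noteq> p" by (simp add: eventually_at_filter)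
    ultimately show "\<forall>\<^sub>F q in at p. norm ((f q - f p) / (q - p) - j p) \<le> \<bar>j q - j p\<bar>"
      by eventually_elim (use bd in auto)
    show "((\<lambda>q. \<bar>j q - j p\<bar>) \<longlongrightarrow> 0) (at p)"
      using j by (auto simp: isCont_def intro!: tendsto_eq_intros)
  qed
  then show ?thesis by (simp add: has_field_derivative_iff LIM_zero_iff)
qed

text \<open>Positivity before s excludes f' s > 0. If f' s = 0 with negative second derivative, then
  f' > 0 just before s, so f would increase to its zero and be negative there.\<close>

lemma deriv_neg_at_first_zero:
  fixes f f' :: "real \<Rightarrow> real"
  assumes s: "s > 0" and f: "\<And>t. 0 < t \<Longrightarrow> t \<le> s \<Longrightarrow> (f has_real_derivative f' t) (at t)"
    and pos: "\<And>t. 0 < t \<Longrightarrow> t < s \<Longrightarrow> f t > 0" and zero: "f s = 0"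
    and f'': "f' s = 0 \<Longrightarrow> \<exists>D<0. (f' has_real_derivative D) (at s)"
  shows "f' s < 0"
proof (rule ccontr)
  assume "\<not> f' s < 0"
  then consider "f' s > 0" | "f' s = 0" by linarith
  then show False
  proof cases
    case 1
    from DERIV_pos_inc_left[OF f[OF s order.refl] 1] obtain d where
      d: "d > 0" "\<And>h. 0 < h \<Longrightarrow> h < d \<Longrightarrow> f (s - h) < f s" by auto
    have "0 < min d s / 2" "min d s / 2 < d" "min d s / 2 < s" using d(1) s by auto
    then show False using pos[of "s - min d s / 2"] d(2)[of "min d s / 2"] zero by linarith
  next
    case 2
    with f'' obtain D where D: "D < 0" "(f' has_real_derivative D) (at s)" by auto
    from DERIV_neg_dec_left[OF D(2,1)] obtain d where
      d: "d > 0" "\<And>h. 0 < h \<Longrightarrow> h < d \<Longrightarrow> f' s < f' (s - h)" by auto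
    define t where "t = s - min d s / 2"
    have t: "0 < t" "t < s" using s d unfolding t_def by auto
    have "f t < f s"
    proof (rule DERIV_pos_imp_increasing_open[OF t(2)])
      show "\<exists>y. (f has_real_derivative y) (at u) \<and> 0 < y" if "t < u" "u < s" for u
      proof (intro exI conjI)
        show "(f has_real_derivative f' u) (at u)" using that t by (intro f) auto
        show "0 < f' u" using d(2)[of "s - u"] that 2 d(1) unfolding t_def by auto
      qed
      show "continuous_on {t..s} f"
        using t by (intro continuous_at_imp_continuous_on) (auto intro!: DERIV_isCont[OF f])
    qed
    then show False using pos[OF t] zero by simp
  qed
qed

text \<open>The complement in K is the projection of the compact set where h \<le> 0, hence
  closed.\<close>

lemma openin_uniformly_positive:
  fixes h :: "'a::metric_space \<Rightarrow> real \<Rightarrow> real"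
  assumes K: "compact K" and h: "continuous_on (K \<times> {0..S}) (\<lambda>(a, s). h a s)"
  shows "openin (top_of_set K) {a \<in> K. \<forall>s\<in>{0..S}. h a s > 0}"
proof -
  let ?B = "{p \<in> K \<times> {0..S}. (\<lambda>(a, s). h a s) p \<in> {..0}}"
  have "closedin (top_of_set (K \<times> {0..S})) ?B"
    using continuous_closedin_preimage[OF h closed_atMost] by (simp add: vimage_def Int_def)
  then have "compact ?B"
    using K closedin_compact compact_Times compact_Icc by blast
  then have "closed (fst ` ?B)"
    by (intro compact_imp_closed compact_continuous_image continuous_intros)
  moreover have "{a \<in> K. \<forall>s\<in>{0..S}. h a s > 0} = K \<inter> - (fst ` ?B)"
    by (force simp: not_less image_iff)
  ultimately show ?thesis unfolding openin_open by blast
qed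

text \<open>Turns a transversal zero into a strict crossing during which the other constraint g
  still holds. Derivatives within \<open>{0..}\<close> admit s = 0.\<close>

lemma neg_right_of_zero:
  fixes f g :: "real \<Rightarrow> real"
  assumes s: "s \<ge> 0" and f: "(f has_real_derivative D) (at s within {0..})" "D < 0" "f s = 0"
    and g: "continuous (at s within {0..}) g" "g s > 0"
  shows "\<exists>s1>s. f s1 < 0 \<and> (\<forall>t\<in>{s..s1}. g t > 0)"
proof -
  obtain d1 where d1: "d1 > 0" "\<And>h. 0 < h \<Longrightarrow> s + h \<in> {0..} \<Longrightarrow> h < d1 \<Longrightarrow> f (s + h) < f s"
    using has_real_derivative_neg_dec_right[OF f(1,2)] by auto
  have "\<forall>\<^sub>F t in at s within {0..}. g t > 0"
    using g by (intro order_tendstoD) (auto simp: continuous_within)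
  then obtain d2 where d2: "d2 > 0" "\<forall>t\<in>{0..}. t \<noteq> s \<and> dist t s < d2 \<longrightarrow> g t > 0"
    unfolding eventually_at by blast
  define h where "h = min d1 d2 / 2"
  have h: "h > 0" "h < d1" "h < d2" using d1(1) d2(1) by (auto simp: h_def)
  have "g t > 0" if "t \<in> {s..s + h}" for t
    using d2(2)[rule_format, of t] g(2) that s h by (cases "t = s") (auto simp: dist_real_def)
  moreover have "f (s + h) < 0" using d1(2)[of h] h s f(3) by simp
  ultimately show ?thesis using h by (intro exI[of _ "s + h"]) auto
qed

lemma at_within_Ioc: "0 < y \<Longrightarrow> y < a \<Longrightarrow> at y within {0<..a} = at (y::real)"
  by (rule at_within_nhd[of y "{0<..<a}"]) auto

lemma DERIV_chain_subset:
  assumes "(f has_real_derivative D) (at (g x) within T)" "(g has_real_derivative E) (at x within S)" "g ` S \<subseteq> T"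
  shows "((\<lambda>x. f (g x)) has_real_derivative D * E) (at x within S)"
  using DERIV_image_chain[OF has_field_derivative_subset[OF assms(1,3)] assms(2)] by (simp add: o_def)

lemma at_within_Ici: "s > 0 \<Longrightarrow> at s within {0..} = at (s::real)"
  by (rule at_within_interior) simp

section \<open>The system in abstract form and the extension of its coefficients beyond
  \<phi>0\<close>

locale dual_system =
  fixes k r \<rho> \<delta> \<alpha> \<Lambda> \<phi>0 :: real and I G :: "real \<Rightarrow> real"
  assumes k: "k > 0" and r: "r \<ge> 0" and \<rho>: "\<rho> > 0" and \<delta>: "\<delta> > 0" and \<alpha>: "\<alpha> > 0"
    and \<Lambda>: "\<Lambda> < 0" and \<Lambda>_eq: "k * \<Lambda> * (\<Lambda> - 1) = (r + \<rho> - \<delta>) * \<Lambda> + \<delta>"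
    and \<phi>0: "\<phi>0 > 0"
    and I_nonneg: "\<And>p. p \<in> {0<..\<phi>0} \<Longrightarrow> I p \<ge> 0"
    and continuous_on_I: "continuous_on {0<..\<phi>0} I"
    and deriv_I: "\<And>p. p \<in> {0<..<\<phi>0} \<Longrightarrow> \<exists>d<0. (I has_real_derivative d) (at p)"
    and I_at_0: "filterlim I at_top (at_right 0)"
    and G_subgradient: "\<And>p q. p \<in> {0<..\<phi>0} \<Longrightarrow> q \<in> {0<..\<phi>0} \<Longrightarrow> G p - (\<alpha> + I p) * (q - p) \<le> G q"
begin

text \<open>The functions \<open>J\<close> and \<open>G_ext\<close> continue \<open>\<alpha> + I\<close> and \<open>G\<close> past \<open>\<phi>0\<close> so that \<open>G_ext' = - J\<close> on all of \<open>(0,\<infinity>)\<close>.\<close>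

definition J :: "real \<Rightarrow> real" where "J p = \<alpha> + I (min p \<phi>0)"

definition G_ext :: "real \<Rightarrow> real" where "G_ext p = G (min p \<phi>0) - J p * (p - min p \<phi>0)"

lemma J_pos: "p > 0 \<Longrightarrow> J p > 0"
  using I_nonneg[of "min p \<phi>0"] \<alpha> \<phi>0 by (auto simp: J_def)

lemma I_antimono:
  assumes "p \<in> {0<..\<phi>0}" "q \<in> {0<..\<phi>0}" "p \<le> q"
  shows "I q \<le> I p"
proof (cases "p = q")
  case False
  have "(q - p) * I q \<le> (q - p) * I p"
    using G_subgradient[OF assms(1,2)] G_subgradient[OF assms(2,1)] by (simp add: algebra_simps)
  then show ?thesis using False assms by simp
qed simp

lemma J_antimono: "0 < p \<Longrightarrow> p \<le> q \<Longrightarrow> J q \<le> J p"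
  unfolding J_def using \<phi>0 I_antimono[of "min p \<phi>0" "min q \<phi>0"] by auto

lemma isCont_J: "p > 0 \<Longrightarrow> isCont J p"
proof -
  assume p: "p > 0"
  have "continuous_on {0<..} (\<lambda>p. I (min p \<phi>0))"
    using \<phi>0 by (intro continuous_on_compose2[OF continuous_on_I]) (auto intro!: continuous_intros)
  then have "continuous_on {0<..} J" unfolding J_def by (intro continuous_intros)
  with p show ?thesis by (auto simp: continuous_on_eq_continuous_at)
qed

lemma deriv_J:
  assumes "p \<in> {0<..<\<phi>0}"
  shows "\<exists>d<0. (J has_real_derivative d) (at p)"
proof -
  obtain d where d: "d < 0" "(I has_real_derivative d) (at p)" using deriv_I[OF assms] by blast
  then have "((\<lambda>p. \<alpha> + I p) has_real_derivative d) (at p)" by (auto intro!: derivative_eq_intros)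
  moreover have "\<forall>\<^sub>F q in nhds p. \<alpha> + I q = J q"
    using eventually_nhds_in_open[of "{0<..<\<phi>0}" p] assms by (auto elim!: eventually_mono simp: J_def)
  ultimately have "(J has_real_derivative d) (at p)"
    by (subst DERIV_cong_ev[symmetric]) auto
  with d show ?thesis by blast
qed

text \<open>Continuation along the tangent at \<phi>0 preserves convexity: the truncated points
  satisfy the old inequality, and for the overhang of q beyond \<phi>0 the slopes are compared by
  monotonicity of J.\<close>

lemma G_ext_subgradient:
  assumes "p > 0" "q > 0"
  shows "G_ext p - J p * (q - p) \<le> G_ext q"
proof -
  have *: "G (min p \<phi>0) - J p * (min q \<phi>0 - min p \<phi>0) \<le> G (min q \<phi>0)"
    using G_subgradient[of "min p \<phi>0" "min q \<phi>0"] assms \<phi>0 by (auto simp: J_def)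
  have "J q * (q - min q \<phi>0) \<le> J p * (q - min q \<phi>0)"
  proof (cases "p \<le> q")
    case True
    then show ?thesis using J_antimono[of p q] assms by (intro mult_right_mono) auto
  next
    case False
    then have "q \<le> \<phi>0 \<or> J q = J p" by (auto simp: J_def min_def)
    then show ?thesis by (auto simp: min_def)
  qed
  with * show ?thesis by (simp add: G_ext_def algebra_simps)
qed

lemma deriv_G_ext: "p > 0 \<Longrightarrow> (G_ext has_real_derivative - J p) (at p)"
  by (rule real_derivative_of_subgradient[of "{0<..}"])
    (use G_ext_subgradient in \<open>auto intro!: continuous_intros isCont_J simp: algebra_simps\<close>)

lemma G_ext_lipschitz:
  assumes "l > 0" "p \<ge> l" "q \<ge> l"
  shows "\<bar>G_ext p - G_ext q\<bar> \<le> J l * \<bar>p - q\<bar>"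
proof -
  have *: "G_ext p - G_ext q \<le> J l * \<bar>p - q\<bar>" if "p \<ge> l" "q \<ge> l" for p q
  proof -
    have "G_ext p - G_ext q \<le> J p * (q - p)" using G_ext_subgradient[of p q] that assms by simp
    also have "\<dots> \<le> J p * \<bar>p - q\<bar>" using J_pos[of p] that assms by (intro mult_left_mono) auto
    also have "\<dots> \<le> J l * \<bar>p - q\<bar>" using J_antimono[of l p] that assms by (intro mult_right_mono) auto
    finally show ?thesis .
  qed
  show ?thesis using *[of p q] *[of q p] assms by (simp add: abs_minus_commute abs_le_iff)
qed

text \<open>The parameter a at which the initial value (1 - \<Lambda>)(\<phi>0 - a) of W equals
  \<phi>0, that is \<psi> = 1 at the free boundary.\<close>

definition y_min :: real where "y_min = \<phi>0 * \<Lambda> / (\<Lambda> - 1)"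

definition rate :: "real \<Rightarrow> real \<Rightarrow> real \<Rightarrow> real \<Rightarrow> real" where
  "rate a s p w = ((p - w) * (r + \<rho> - \<delta> - \<rho> * J p) + \<delta> * p - (r + \<rho>) * (a * exp (- s))) / k"

text \<open>
  Here \<open>\<Phi>\<close> and \<open>W\<close> are \<open>\<phi>\<close> and \<open>\<phi> \<cdot> \<psi>\<close> as functions of \<open>s = ln (a / y)\<close>.  Since \<open>G\<close> is Lipschitz only away from
  \<open>0\<close>, the flow is cut off below \<open>\<phi>0 * exp (- s) / 2\<close>; a trajectory does not notice this while \<open>W \<ge> 0\<close>,
  because then \<open>\<Phi> s \<ge> \<phi>0 * exp (- s)\<close>.
\<close>

definition flow :: "real \<Rightarrow> (real \<Rightarrow> real) \<Rightarrow> (real \<Rightarrow> real) \<Rightarrow> bool" where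
  "flow a \<Phi> W \<longleftrightarrow> \<Phi> 0 = \<phi>0 \<and> W 0 = (1 - \<Lambda>) * (\<phi>0 - a) \<and>
     (\<forall>s\<ge>0. (\<Phi> has_real_derivative - \<Phi> s + W s) (at s within {0..}) \<and>
        (\<phi>0 * exp (- s) / 2 < \<Phi> s \<longrightarrow> (W has_real_derivative rate a s (\<Phi> s) (W s)) (at s within {0..})))"

lemma flow_exists:
  assumes K: "compact K"
  shows "\<exists>\<Phi> W. (\<forall>S. continuous_on (K \<times> {0..S}) (\<lambda>(a, s). \<Phi> a s)) \<and>
    (\<forall>S. continuous_on (K \<times> {0..S}) (\<lambda>(a, s). W a s)) \<and> (\<forall>a\<in>K. flow a (\<Phi> a) (W a))"
proof -
  define b where "b = r + \<rho> - \<delta>"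
  define m where "m = (\<lambda>s p. max p (\<phi>0 * exp (- s) / 2))"
  \<comment> \<open>The definition of V solved for w, with y = a exp (- s) and G taken at the
    cut-off argument.\<close>
  define w where "w = (\<lambda>a s p v. (v - \<rho> * G_ext (m s p) + b * (a * exp (- s) - p)) / k)"
  define f where "f = (\<lambda>a s x. (- fst x + w a s (fst x) (snd x), \<delta> * (fst x - a * exp (- s))))"
  have m_pos: "m s p > 0" for s p
    using \<phi>0 by (simp add: m_def less_max_iff_disj)
  have cont_Ge: "continuous_on {0<..} G_ext"
    by (intro continuous_at_imp_continuous_on) (auto intro!: DERIV_isCont[OF deriv_G_ext])
  have cont_w: "continuous_on X (\<lambda>x. w (a x) (s x) (p x) (v x))"
    if "continuous_on X a" "continuous_on X s" "continuous_on X p" "continuous_on X v"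
    for X :: "'x::topological_space set" and a s p v
    unfolding w_def m_def using that k m_pos
    by (intro continuous_intros continuous_on_compose2[OF cont_Ge]) (auto simp: m_def)
  have lip: "\<exists>L. \<forall>a\<in>K. \<forall>s\<in>{0..S}. \<forall>x y. norm (f a s x - f a s y) \<le> L * norm (x - y)" for S
  proof (intro exI ballI allI)
    fix a s :: real and x y :: "real \<times> real"
    assume s: "s \<in> {0..S}"
    \<comment> \<open>A lower bound for the cut-off argument on all of \<open>{0..S}\<close>, which
      makes \<open>J l\<close> a Lipschitz constant for G there.\<close>
    define l where "l = \<phi>0 * exp (- S) / 2"
    have "exp (- S) \<le> exp (- s)" using s by simp
    then have l: "l > 0" "l \<le> m s p" for p
      using \<phi>0 by (auto simp: l_def m_def le_max_iff_disj)
    define N where "N = norm (x - y)"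
    have N: "\<bar>fst x - fst y\<bar> \<le> N" "\<bar>snd x - snd y\<bar> \<le> N"
      using norm_fst_le[of "fst (x - y)" "snd (x - y)", unfolded prod.collapse]
        norm_snd_le[of "snd (x - y)" "fst (x - y)", unfolded prod.collapse] by (simp_all add: N_def)
    have "\<bar>G_ext (m s (fst x)) - G_ext (m s (fst y))\<bar> \<le> J l * \<bar>m s (fst x) - m s (fst y)\<bar>"
      using l by (intro G_ext_lipschitz) auto
    also have "\<dots> \<le> J l * N"
      using J_pos[OF l(1)] N by (intro mult_left_mono) (auto simp: m_def)
    finally have 1: "\<bar>\<rho> * (G_ext (m s (fst x)) - G_ext (m s (fst y)))\<bar> \<le> \<rho> * (J l * N)"
      using \<rho> by (simp add: abs_mult)
    have 2: "\<bar>b * (fst x - fst y)\<bar> \<le> \<bar>b\<bar> * N"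
      using N by (simp add: abs_mult mult_left_mono)
    have "\<bar>w a s (fst x) (snd x) - w a s (fst y) (snd y)\<bar> =
       \<bar>(snd x - snd y) - \<rho> * (G_ext (m s (fst x)) - G_ext (m s (fst y))) - b * (fst x - fst y)\<bar> / k"
      using k by (simp add: w_def diff_divide_distrib[symmetric] algebra_simps)
    also have "\<dots> \<le> (N + \<rho> * (J l * N) + \<bar>b\<bar> * N) / k"
      using 1 2 N k by (intro divide_right_mono) linarith+
    finally have 3: "\<bar>w a s (fst x) (snd x) - w a s (fst y) (snd y)\<bar> \<le> (1 + \<rho> * J l + \<bar>b\<bar>) / k * N"
      by (simp add: algebra_simps)
    have 4: "\<bar>\<delta> * (fst x - fst y)\<bar> \<le> \<delta> * N" using N \<delta> by (simp add: abs_mult)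
    have "norm (f a s x - f a s y) \<le> \<bar>fst (f a s x - f a s y)\<bar> + \<bar>snd (f a s x - f a s y)\<bar>"
      by (simp add: norm_prod_def sqrt_sum_squares_le_sum_abs)
    also have "\<dots> = \<bar>- (fst x - fst y) + (w a s (fst x) (snd x) - w a s (fst y) (snd y))\<bar> + \<bar>\<delta> * (fst x - fst y)\<bar>"
      by (simp add: f_def algebra_simps)
    also have "\<dots> \<le> N + (1 + \<rho> * J l + \<bar>b\<bar>) / k * N + \<delta> * N"
      using 3 4 N by linarith
    finally show "norm (f a s x - f a s y) \<le> (1 + (1 + \<rho> * J (\<phi>0 * exp (- S) / 2) + \<bar>b\<bar>) / k + \<delta>) * norm (x - y)"
      by (simp add: N_def l_def distrib_right)
  qed
  \<comment> \<open>The second component is V at s = 0, obtained from w = (1 - \<Lambda>)(\<phi>0 -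
    a) and y = a.\<close>
  define x0 where "x0 = (\<lambda>a. (\<phi>0, \<rho> * G_ext \<phi>0 + (b + k * (1 - \<Lambda>)) * (\<phi>0 - a)))"
  have c0: "continuous_on K x0" unfolding x0_def by (intro continuous_intros)
  have "continuous_on (K \<times> {0..} \<times> UNIV) (\<lambda>(a, s, x). f a s x)"
    unfolding f_def case_prod_unfold by (intro continuous_intros cont_w)
  from parametric_ode_solution[OF K c0 this lip] obtain X where X: "\<And>S. continuous_on (K \<times> {0..S}) (\<lambda>(a, s). X a s)"
    and X0: "\<And>a. a \<in> K \<Longrightarrow> X a 0 = x0 a"
    and X': "\<And>a s. a \<in> K \<Longrightarrow> s \<ge> 0 \<Longrightarrow> (X a has_vector_derivative f a s (X a s)) (at s within {0..})"
    by blast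
  define \<Phi> where "\<Phi> = (\<lambda>a s. fst (X a s))"
  define V where "V = (\<lambda>a s. snd (X a s))"
  define W where "W = (\<lambda>a s. w a s (\<Phi> a s) (V a s))"
  have cont: "continuous_on (K \<times> {0..S}) (\<lambda>(a, s). \<Phi> a s)" "continuous_on (K \<times> {0..S}) (\<lambda>(a, s). V a s)" for S
    using X[of S] unfolding \<Phi>_def V_def case_prod_unfold by (auto intro!: continuous_intros)
  have "continuous_on (K \<times> {0..S}) (\<lambda>(a, s). W a s)" for S
    using cont[of S] unfolding W_def case_prod_unfold by (intro cont_w continuous_intros)
  moreover have "flow a (\<Phi> a) (W a)" if a: "a \<in> K" for a
    unfolding flow_def
  proof (intro conjI allI impI)
    have "exp (- 0 :: real) / 2 \<le> 1" by simp
    then have "m 0 \<phi>0 = \<phi>0" using \<phi>0 by (simp add: m_def)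
    then show "\<Phi> a 0 = \<phi>0" "W a 0 = (1 - \<Lambda>) * (\<phi>0 - a)"
      using k X0[OF a] by (simp_all add: \<Phi>_def V_def W_def w_def x0_def field_simps)
  next
    fix s :: real assume s: "s \<ge> 0"
    have D: "(\<Phi> a has_real_derivative - \<Phi> a s + W a s) (at s within {0..})"
      using bounded_linear.has_vector_derivative[OF bounded_linear_fst X'[OF a s]]
      by (simp add: f_def \<Phi>_def V_def W_def has_real_derivative_iff_has_vector_derivative)
    have DV: "(V a has_real_derivative \<delta> * (\<Phi> a s - a * exp (- s))) (at s within {0..})"
      using bounded_linear.has_vector_derivative[OF bounded_linear_snd X'[OF a s]]
      by (simp add: f_def \<Phi>_def V_def W_def has_real_derivative_iff_has_vector_derivative)
    show "(\<Phi> a has_real_derivative - \<Phi> a s + W a s) (at s within {0..})" by (rule D)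
    assume gt: "\<phi>0 * exp (- s) / 2 < \<Phi> a s"
    \<comment> \<open>W without the cut-off. By strictness of \<open>gt\<close> and continuity of
      \<Phi> the two coincide near s, so the derivative of W can be computed from W0, where G is
      evaluated at \<Phi> itself.\<close>
    define W0 where "W0 = (\<lambda>t. (V a t - \<rho> * G_ext (\<Phi> a t) + b * (a * exp (- t) - \<Phi> a t)) / k)"
    have pos: "\<Phi> a s > 0" using gt \<phi>0 by (smt (verit) divide_pos_pos exp_gt_zero mult_pos_pos)
    have W0s: "W a s = W0 s" using gt by (simp add: W_def w_def W0_def m_def)
    have DG: "((\<lambda>t. G_ext (\<Phi> a t)) has_real_derivative - J (\<Phi> a s) * (- \<Phi> a s + W a s)) (at s within {0..})"
      by (rule DERIV_chain2[where g = "\<Phi> a" and x = s, OF deriv_G_ext[OF pos] D])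
    have DE: "((\<lambda>t. exp (- t)) has_real_derivative exp (- s) * - 1) (at s within {0..})"
      by (auto intro!: derivative_eq_intros)
    have "(W0 has_real_derivative (\<delta> * (\<Phi> a s - a * exp (- s)) - \<rho> * (- J (\<Phi> a s) * (- \<Phi> a s + W a s))
        + b * (a * (exp (- s) * - 1) - (- \<Phi> a s + W a s))) / k) (at s within {0..})"
      unfolding W0_def by (intro DERIV_cdivide DERIV_add DERIV_diff DERIV_cmult D DV DG DE)
    also have "(\<delta> * (\<Phi> a s - a * exp (- s)) - \<rho> * (- J (\<Phi> a s) * (- \<Phi> a s + W a s))
        + b * (a * (exp (- s) * - 1) - (- \<Phi> a s + W a s))) / k = rate a s (\<Phi> a s) (W a s)"
      by (simp add: rate_def b_def algebra_simps)
    finally have D0: "(W0 has_real_derivative rate a s (\<Phi> a s) (W a s)) (at s within {0..})" .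
    have "((\<lambda>t. \<Phi> a t - \<phi>0 * exp (- t) / 2) \<longlongrightarrow> \<Phi> a s - \<phi>0 * exp (- s) / 2) (at s within {0..})"
      using DERIV_continuous[OF D] by (intro tendsto_intros) (auto simp: continuous_within)
    then have "\<forall>\<^sub>F t in at s within {0..}. \<Phi> a t - \<phi>0 * exp (- t) / 2 > 0"
      using gt by (intro order_tendstoD) auto
    then have "\<forall>\<^sub>F t in at s within {0..}. W0 t = W a t"
      by eventually_elim (simp add: W_def w_def W0_def m_def max_def)
    then show "(W a has_real_derivative rate a s (\<Phi> a s) (W a s)) (at s within {0..})"
      using D0 W0s has_field_derivative_cong_eventually[of W0 "W a" s "{0..}"] by metis
  qed
  ultimately show ?thesis using cont by blast
qed

lemma y_min_pos: "y_min > 0"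
  unfolding y_min_def using \<phi>0 \<Lambda> by (simp add: zero_less_divide_iff mult_less_0_iff)

text \<open>For a = \<open>y_min\<close> the trajectory starts with W = \<Phi> = \<phi>0, and the
  left-hand side is then k times the initial rate of W. The characteristic equation of \<Lambda>
  makes it positive, so W overtakes \<Phi> at once.\<close>

lemma rate_at_y_min: "\<delta> * \<phi>0 - (r + \<rho>) * y_min = - (k * \<Lambda> * \<phi>0)"
proof -
  have *: "(\<Lambda> - 1) * y_min = \<phi>0 * \<Lambda>" using \<Lambda> by (simp add: y_min_def)
  have "(\<Lambda> - 1) * (\<delta> * \<phi>0 - (r + \<rho>) * y_min) = (\<Lambda> - 1) * \<delta> * \<phi>0 - (r + \<rho>) * ((\<Lambda> - 1) * y_min)"
    by (simp add: algebra_simps)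
  also have "\<dots> = (\<delta> * (\<Lambda> - 1) - (r + \<rho>) * \<Lambda>) * \<phi>0"
    unfolding * by (simp add: algebra_simps)
  also have "\<delta> * (\<Lambda> - 1) - (r + \<rho>) * \<Lambda> = - (k * \<Lambda> * (\<Lambda> - 1))"
    by (simp only: \<Lambda>_eq) (simp add: algebra_simps)
  finally have "(\<Lambda> - 1) * (\<delta> * \<phi>0 - (r + \<rho>) * y_min) = (\<Lambda> - 1) * (- (k * \<Lambda> * \<phi>0))"
    by (simp add: algebra_simps)
  then show ?thesis by (rule mult_left_cancel[THEN iffD1, rotated]) (use \<Lambda> in simp)
qed

section \<open>A single trajectory and its exits from 0 < W < \<Phi>\<close>

context
  fixes a :: real and \<Phi> W :: "real \<Rightarrow> real"
  assumes flow: "flow a \<Phi> W"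
begin

lemma flow_0: "\<Phi> 0 = \<phi>0" "W 0 = (1 - \<Lambda>) * (\<phi>0 - a)"
  and deriv_\<Phi>: "s \<ge> 0 \<Longrightarrow> (\<Phi> has_real_derivative - \<Phi> s + W s) (at s within {0..})"
  and deriv_W: "s \<ge> 0 \<Longrightarrow> \<phi>0 * exp (- s) / 2 < \<Phi> s \<Longrightarrow> (W has_real_derivative rate a s (\<Phi> s) (W s)) (at s within {0..})"
  using flow unfolding flow_def by auto

lemma continuous_on_\<Phi>: "continuous_on {0..} \<Phi>"
  by (rule DERIV_continuous_on, rule deriv_\<Phi>) simp

text \<open>The derivative of \<Phi> s exp s is W s exp s. The bound is twice the cut-off level, so
  the equation for W is in force while W has stayed nonnegative.\<close>

lemma \<Phi>_lower:
  assumes s: "s \<ge> 0" and W: "\<And>t. 0 < t \<Longrightarrow> t < s \<Longrightarrow> W t \<ge> 0"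
  shows "\<phi>0 * exp (- s) \<le> \<Phi> s"
proof -
  have "\<Phi> 0 * exp 0 \<le> \<Phi> s * exp s"
  proof (rule DERIV_nonneg_imp_increasing_open[OF s])
    show "\<exists>y. ((\<lambda>t. \<Phi> t * exp t) has_real_derivative y) (at t) \<and> y \<ge> 0" if "0 < t" "t < s" for t
      using deriv_\<Phi>[of t] that W[of t]
      by (intro exI[of _ "W t * exp t"]) (auto simp: at_within_Ici algebra_simps intro!: derivative_eq_intros)
    show "continuous_on {0..s} (\<lambda>t. \<Phi> t * exp t)"
      by (intro continuous_intros continuous_on_subset[OF continuous_on_\<Phi>]) auto
  qed
  then have "\<phi>0 \<le> \<Phi> s * exp s" by (simp add: flow_0)
  then have "\<phi>0 * exp (- s) \<le> (\<Phi> s * exp s) * exp (- s)" by (intro mult_right_mono) auto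
  then show ?thesis by (simp add: mult.assoc flip: exp_add)
qed

lemma \<Phi>_less:
  assumes "0 \<le> s" "s < t" and W: "\<And>u. s < u \<Longrightarrow> u < t \<Longrightarrow> W u < \<Phi> u"
  shows "\<Phi> t < \<Phi> s"
proof (rule DERIV_neg_imp_decreasing_open[OF assms(2)])
  show "\<exists>y. (\<Phi> has_real_derivative y) (at u) \<and> y < 0" if "s < u" "u < t" for u
    using deriv_\<Phi>[of u] that W[of u] assms by (auto simp: at_within_Ici)
  show "continuous_on {s..t} \<Phi>"
    using assms by (intro continuous_on_subset[OF continuous_on_\<Phi>]) auto
qed

text \<open>Second derivative for the transversality test, kept in the raw form of the product rule;
  it collapses once W = 0 or W = \<Phi> is inserted together with a vanishing first
  derivative.\<close>

lemma deriv_rate: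
  assumes s: "s > 0" and \<Phi>: "\<Phi> s > \<phi>0 * exp (- s) / 2" and J: "(J has_real_derivative d) (at (\<Phi> s))"
  shows "((\<lambda>t. rate a t (\<Phi> t) (W t)) has_real_derivative
     ((- \<Phi> s + W s - rate a s (\<Phi> s) (W s)) * (r + \<rho> - \<delta> - \<rho> * J (\<Phi> s))
      + (- (\<rho> * (d * (- \<Phi> s + W s)))) * (\<Phi> s - W s)
      + \<delta> * (- \<Phi> s + W s) - (r + \<rho>) * (a * (- exp (- s)))) / k) (at s)"
proof -
  define R where "R = rate a s (\<Phi> s) (W s)"
  have D: "(\<Phi> has_real_derivative - \<Phi> s + W s) (at s)" "(W has_real_derivative R) (at s)"
    using deriv_\<Phi>[of s] deriv_W[of s] s \<Phi> by (auto simp: at_within_Ici R_def)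
  have DJ: "((\<lambda>t. r + \<rho> - \<delta> - \<rho> * J (\<Phi> t)) has_real_derivative - (\<rho> * (d * (- \<Phi> s + W s)))) (at s)"
    using DERIV_chain2[OF J D(1)] by (auto intro!: derivative_eq_intros)
  have DE: "((\<lambda>t. exp (- t)) has_real_derivative - exp (- s)) (at s)"
    by (auto intro!: derivative_eq_intros)
  show ?thesis
    unfolding R_def[symmetric] unfolding rate_def by (intro DERIV_cdivide DERIV_add DERIV_diff DERIV_mult DERIV_cmult D DJ DE)
qed

lemma flow_exit:
  assumes a: "y_min \<le> a" and s: "s \<ge> 0" and good: "\<And>t. 0 \<le> t \<Longrightarrow> t < s \<Longrightarrow> 0 < W t \<and> W t < \<Phi> t"
  shows "W s = 0 \<Longrightarrow> \<exists>s1>s. W s1 < 0 \<and> (\<forall>t\<in>{s..s1}. W t < \<Phi> t)"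
    and "W s = \<Phi> s \<Longrightarrow> \<exists>s1>s. W s1 > \<Phi> s1 \<and> (\<forall>t\<in>{s..s1}. W t > 0)"
proof -
  have lower: "\<phi>0 * exp (- t) / 2 < \<Phi> t" "\<Phi> t > 0" if "0 \<le> t" "t \<le> s" for t
  proof -
    have "\<phi>0 * exp (- t) > 0" using \<phi>0 by simp
    moreover have "\<phi>0 * exp (- t) \<le> \<Phi> t"
      using good that by (intro \<Phi>_lower) (auto intro: less_imp_le)
    ultimately show "\<phi>0 * exp (- t) / 2 < \<Phi> t" "\<Phi> t > 0" by linarith+
  qed
  have DW: "(W has_real_derivative rate a t (\<Phi> t) (W t)) (at t within {0..})" if "0 \<le> t" "t \<le> s" for t
    using deriv_W[of t] lower[of t] that by auto
  have DZ: "((\<lambda>t. \<Phi> t - W t) has_real_derivative - \<Phi> t + W t - rate a t (\<Phi> t) (W t)) (at t within {0..})"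
    if "0 \<le> t" "t \<le> s" for t
    using deriv_\<Phi>[of t] DW[of t] that by (intro DERIV_diff) auto
  \<comment> \<open>For s > 0 the strict decrease of \<Phi> has moved it below \<phi>0, into the
    region where J is differentiable. This fails at s = 0, hence the case splits below.\<close>
  have deriv_J_s: "\<exists>d<0. (J has_real_derivative d) (at (\<Phi> s))" if "s > 0"
    using \<Phi>_less[of 0 s] good that lower[of s] by (intro deriv_J) (auto simp: flow_0)
  have "W s = 0 \<Longrightarrow> rate a s (\<Phi> s) (W s) < 0"
  proof (cases "s = 0")
    case True
    assume "W s = 0"
    \<comment> \<open>With y = \<Phi> = \<phi>0 the terms in \<delta> and r + \<rho> cancel, and
      only the contribution of J remains.\<close>
    then have "a = \<phi>0" using True flow_0 \<Lambda> by simp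
    then have "rate a s (\<Phi> s) (W s) = - (\<rho> * J \<phi>0 * \<phi>0) / k"
      using True flow_0 by (simp add: rate_def algebra_simps)
    then show ?thesis using \<rho> J_pos[OF \<phi>0] \<phi>0 k by simp
  next
    case False
    assume W: "W s = 0"
    with False s have s': "s > 0" by simp
    show ?thesis
    proof (rule deriv_neg_at_first_zero[where f = W and f' = "\<lambda>t. rate a t (\<Phi> t) (W t)", OF s' _ _ W])
      show "(W has_real_derivative rate a t (\<Phi> t) (W t)) (at t)" if "0 < t" "t \<le> s" for t
        using DW[of t] that by (simp add: at_within_Ici)
      show "W t > 0" if "0 < t" "t < s" for t using good that by simp
      assume z: "rate a s (\<Phi> s) (W s) = 0"
      obtain d where d: "d < 0" "(J has_real_derivative d) (at (\<Phi> s))" using deriv_J_s[OF s'] by blast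
      \<comment> \<open>The numerator of the rate, which reappears with opposite sign in the
        derivative of the rate; what survives is the term with J'.\<close>
      from z have "\<Phi> s * (r + \<rho> - \<delta> - \<rho> * J (\<Phi> s)) + \<delta> * \<Phi> s - (r + \<rho>) * (a * exp (- s)) = 0"
        using k by (simp add: rate_def W)
      then have "((- \<Phi> s + W s - rate a s (\<Phi> s) (W s)) * (r + \<rho> - \<delta> - \<rho> * J (\<Phi> s))
          + (- (\<rho> * (d * (- \<Phi> s + W s)))) * (\<Phi> s - W s)
          + \<delta> * (- \<Phi> s + W s) - (r + \<rho>) * (a * (- exp (- s)))) = \<rho> * d * (\<Phi> s)\<^sup>2"
        unfolding z unfolding W by (simp add: power2_eq_square)
      moreover have "\<rho> * d * (\<Phi> s)\<^sup>2 / k < 0"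
        using \<rho> d lower[of s] s k by (intro divide_neg_pos mult_neg_pos mult_pos_neg) auto
      ultimately show "\<exists>D<0. ((\<lambda>t. rate a t (\<Phi> t) (W t)) has_real_derivative D) (at s)"
        using deriv_rate[OF s' lower(1)[OF s order.refl] d(2)] by (intro exI[of _ "\<rho> * d * (\<Phi> s)\<^sup>2 / k"]) simp
    qed
  qed
  moreover have "continuous (at s within {0..}) (\<lambda>t. \<Phi> t - W t)" "continuous (at s within {0..}) W"
    using DERIV_continuous[OF DZ] DERIV_continuous[OF DW] s by auto
  ultimately show "W s = 0 \<Longrightarrow> \<exists>s1>s. W s1 < 0 \<and> (\<forall>t\<in>{s..s1}. W t < \<Phi> t)"
    using neg_right_of_zero[OF s DW[OF s order.refl], of "\<lambda>t. \<Phi> t - W t"] lower[OF s order.refl] by simp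
  assume W: "W s = \<Phi> s"
  have "- \<Phi> s + W s - rate a s (\<Phi> s) (W s) < 0"
  proof (cases "s = 0")
    case True
    then have "(1 - \<Lambda>) * (\<phi>0 - a) = \<phi>0" using W flow_0 by simp
    then have "a = y_min" using \<Lambda> by (simp add: y_min_def field_simps)
    then have "rate a s (\<Phi> s) (W s) = - (k * \<Lambda> * \<phi>0) / k"
      using True flow_0 W rate_at_y_min by (simp add: rate_def)
    then show ?thesis using \<Lambda> \<phi>0 k W by (simp add: mult_neg_pos)
  next
    case False
    with s have s': "s > 0" by simp
    show ?thesis
    proof (rule deriv_neg_at_first_zero[where f = "\<lambda>t. \<Phi> t - W t" and
          f' = "\<lambda>t. - \<Phi> t + W t - rate a t (\<Phi> t) (W t)", OF s'])
      show "((\<lambda>t. \<Phi> t - W t) has_real_derivative - \<Phi> t + W t - rate a t (\<Phi> t) (W t)) (at t)"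
        if "0 < t" "t \<le> s" for t using DZ[of t] that by (simp add: at_within_Ici)
      show "\<Phi> t - W t > 0" if "0 < t" "t < s" for t using good that by simp
      show "\<Phi> s - W s = 0" using W by simp
      assume z: "- \<Phi> s + W s - rate a s (\<Phi> s) (W s) = 0"
      then have z': "rate a s (\<Phi> s) (W s) = 0" using W by simp
      \<comment> \<open>The sign of d does not matter here: its coefficient contains the square of
        \<Phi> - W, which vanishes. The exponential term alone determines the sign.\<close>
      obtain d where d: "(J has_real_derivative d) (at (\<Phi> s))" using deriv_J_s[OF s'] by blast
      have "((\<lambda>t. - \<Phi> t + W t - rate a t (\<Phi> t) (W t)) has_real_derivative
           - (- \<Phi> s + W s) + rate a s (\<Phi> s) (W s) - ((- \<Phi> s + W s - rate a s (\<Phi> s) (W s)) * (r + \<rho> - \<delta> - \<rho> * J (\<Phi> s))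
      + (- (\<rho> * (d * (- \<Phi> s + W s)))) * (\<Phi> s - W s)
      + \<delta> * (- \<Phi> s + W s) - (r + \<rho>) * (a * (- exp (- s)))) / k) (at s)"
        using deriv_\<Phi>[OF s] DW[OF s order.refl] s'
        by (intro DERIV_diff DERIV_add DERIV_minus deriv_rate[OF s' lower(1)[OF s order.refl] d]) (auto simp: at_within_Ici)
      also have "- (- \<Phi> s + W s) + rate a s (\<Phi> s) (W s) - ((- \<Phi> s + W s - rate a s (\<Phi> s) (W s)) * (r + \<rho> - \<delta> - \<rho> * J (\<Phi> s))
      + (- (\<rho> * (d * (- \<Phi> s + W s)))) * (\<Phi> s - W s)
      + \<delta> * (- \<Phi> s + W s) - (r + \<rho>) * (a * (- exp (- s)))) / k = - ((r + \<rho>) * (a * exp (- s)) / k)"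
        unfolding z' unfolding W by simp
      finally show "\<exists>D<0. ((\<lambda>t. - \<Phi> t + W t - rate a t (\<Phi> t) (W t)) has_real_derivative D) (at s)"
        using r \<rho> k a y_min_pos by (intro exI conjI) (auto intro!: divide_pos_pos mult_pos_pos add_nonneg_pos)
    qed
  qed
  from neg_right_of_zero[OF s DZ[OF s order.refl] this _ DERIV_continuous[OF DW[OF s order.refl]]]
  show "\<exists>s1>s. W s1 > \<Phi> s1 \<and> (\<forall>t\<in>{s..s1}. W t > 0)"
    using W lower[OF s order.refl] by simp
qed

end

section \<open>Choice of the shooting parameter\<close>

lemma y_min_less: "y_min < \<phi>0"
proof -
  have "\<phi>0 * \<Lambda> / (\<Lambda> - 1) = \<phi>0 * (\<Lambda> / (\<Lambda> - 1))" by simp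
  also have "\<dots> < \<phi>0 * 1"
    using \<Lambda> by (intro mult_strict_left_mono \<phi>0) (simp add: neg_divide_less_eq)
  finally show ?thesis by (simp add: y_min_def)
qed

text \<open>By compactness there is a first time with h \<le> 0, where h is the smaller of the
  distances to the two walls. There h = 0, since a negative value would come after an earlier zero,
  h being continuous and initially nonnegative.\<close>

lemma flow_first_exit:
  assumes flow: "flow a \<Phi> W" and a: "a \<in> {y_min..\<phi>0}"
    and W: "\<And>S. continuous_on {0..S} W" and bad: "s \<ge> 0" "\<not> (0 < W s \<and> W s < \<Phi> s)"
  shows "\<exists>t\<ge>0. (\<forall>u. 0 \<le> u \<and> u < t \<longrightarrow> 0 < W u \<and> W u < \<Phi> u) \<and> (W t = 0 \<or> W t = \<Phi> t)"
proof -
  define h where "h = (\<lambda>t. min (W t) (\<Phi> t - W t))"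
  have h: "continuous_on {0..S} h" for S
    unfolding h_def by (intro continuous_intros W continuous_on_subset[OF continuous_on_\<Phi>[OF flow]]) auto
  \<comment> \<open>For a between \<open>y_min\<close> and \<phi>0 the initial value of W lies
    between 0 and \<phi>0.\<close>
  have h0: "h 0 \<ge> 0"
  proof -
    have "(1 - \<Lambda>) * (\<phi>0 - a) \<ge> 0" using a \<Lambda> by simp
    moreover have "(1 - \<Lambda>) * (\<phi>0 - a) \<le> (1 - \<Lambda>) * (\<phi>0 - y_min)" using a \<Lambda> by (intro mult_left_mono) auto
    moreover have "(1 - \<Lambda>) * (\<phi>0 - y_min) = \<phi>0" using \<Lambda> by (simp add: y_min_def field_simps)
    ultimately show ?thesis by (simp add: h_def flow_0[OF flow])
  qed
  define B where "B = {u \<in> {0..s}. h u \<in> {..0}}"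
  have "closedin (top_of_set {0..s}) B"
    using continuous_closedin_preimage[OF h closed_atMost] by (simp add: B_def vimage_def Int_def)
  then have "compact B"
    using closedin_compact compact_Icc by blast
  moreover have "s \<in> B" using bad by (auto simp: B_def h_def)
  ultimately obtain t where t: "t \<in> B" "\<And>u. u \<in> B \<Longrightarrow> t \<le> u"
    using compact_attains_inf[of B] by blast
  then have ts: "0 \<le> t" "t \<le> s" "h t \<le> 0" by (auto simp: B_def)
  have good: "h u > 0" if "0 \<le> u" "u < t" for u
  proof (rule ccontr)
    assume "\<not> h u > 0"
    then have "u \<in> B" using that ts by (simp add: B_def)
    then show False using t(2) that by force
  qed
  have "h t = 0"
  proof (rule ccontr)
    assume "h t \<noteq> 0"
    then have neg: "h t < 0" using ts by simp
    obtain u where "0 \<le> u" "u \<le> t" "h u = 0"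
      using IVT2'[of h t 0 0, OF less_imp_le[OF neg] h0 ts(1) h] by blast
    then show False using good[of u] neg by (cases "u = t") auto
  qed
  then show ?thesis
    using good ts(1) unfolding h_def by (intro exI[of _ t]) (force simp: min_def split: if_splits)
qed

theorem shooting:
  obtains a \<Phi> W where "y_min < a" "a < \<phi>0" "flow a \<Phi> W" "\<And>s. s \<ge> 0 \<Longrightarrow> 0 < W s \<and> W s < \<Phi> s"
proof -
  define K where "K = {y_min..\<phi>0}"
  have K: "compact K" by (simp add: K_def)
  obtain \<Phi> W where \<Phi>: "\<And>S. continuous_on (K \<times> {0..S}) (\<lambda>(a, s). \<Phi> a s)"
    and W: "\<And>S. continuous_on (K \<times> {0..S}) (\<lambda>(a, s). W a s)"
    and flow: "\<And>a. a \<in> K \<Longrightarrow> flow a (\<Phi> a) (W a)"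
    using flow_exists[OF K] by blast
  have slice: "continuous_on {0..S} (W a)" if "a \<in> K" for a S
    by (rule continuous_on_compose2[OF W[of S], of _ "\<lambda>t. (a, t)", simplified])
      (use that in \<open>auto intro!: continuous_intros\<close>)
  \<comment> \<open>A strict inequality at one time and another on a compact time interval: both
    persist under small changes of a, whereas merely touching a wall need not. The condition on the
    past says that the opposite wall was not reached before.\<close>
  define Lo where "Lo = {a \<in> K. \<exists>s\<ge>0. W a s < 0 \<and> (\<forall>t\<in>{0..s}. W a t < \<Phi> a t)}"
  define Hi where "Hi = {a \<in> K. \<exists>s\<ge>0. W a s > \<Phi> a s \<and> (\<forall>t\<in>{0..s}. W a t > 0)}"
  have at: "continuous_on K (\<lambda>a. W a s)" "continuous_on K (\<lambda>a. \<Phi> a s)" if "s \<ge> 0" for s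
  proof -
    have *: "continuous_on K (\<lambda>a. (a, s))" "(\<lambda>a. (a, s)) ` K \<subseteq> K \<times> {0..s}"
      using that by (auto intro!: continuous_intros)
    show "continuous_on K (\<lambda>a. W a s)" "continuous_on K (\<lambda>a. \<Phi> a s)"
      using continuous_on_compose2[OF W *] continuous_on_compose2[OF \<Phi> *] by simp_all
  qed
  have openin_pos: "openin (top_of_set K) {a \<in> K. g a > 0}" if "continuous_on K g" for g :: "real \<Rightarrow> real"
    using continuous_openin_preimage_gen[OF that, of "{0<..}"] by (simp add: vimage_def Int_def)
  have exit: "a \<in> Lo \<union> Hi"
    if a: "a \<in> K" and s: "s \<ge> 0" "\<And>u. 0 \<le> u \<Longrightarrow> u < s \<Longrightarrow> 0 < W a u \<and> W a u < \<Phi> a u"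
      "W a s = 0 \<or> W a s = \<Phi> a s" for a s
  proof -
    have "y_min \<le> a" using a by (simp add: K_def)
    note ex = flow_exit[OF flow[OF a] this s(1)]
    from s(3) show ?thesis
    proof
      assume 0: "W a s = 0"
      have "\<exists>s1>s. W a s1 < 0 \<and> (\<forall>t\<in>{s..s1}. W a t < \<Phi> a t)"
        by (rule ex(1)) (use s(2) 0 in auto)
      then obtain s1 where s1: "s1 > s" "W a s1 < 0" "\<forall>t\<in>{s..s1}. W a t < \<Phi> a t" by blast
      have "W a t < \<Phi> a t" if "t \<in> {0..s1}" for t
        using s(2)[of t] s1(3) that by (cases "t < s") auto
      then have "a \<in> Lo" unfolding Lo_def using a s(1) s1(1,2) by (auto intro!: exI[of _ s1])
      then show ?thesis by simp
    next
      assume 0: "W a s = \<Phi> a s"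
      have "\<exists>s1>s. W a s1 > \<Phi> a s1 \<and> (\<forall>t\<in>{s..s1}. W a t > 0)"
        by (rule ex(2)) (use s(2) 0 in auto)
      then obtain s1 where s1: "s1 > s" "W a s1 > \<Phi> a s1" "\<forall>t\<in>{s..s1}. W a t > 0" by blast
      have "W a t > 0" if "t \<in> {0..s1}" for t
        using s(2)[of t] s1(3) that by (cases "t < s") auto
      then have "a \<in> Hi" unfolding Hi_def using a s(1) s1(1,2) by (auto intro!: exI[of _ s1])
      then show ?thesis by simp
    qed
  qed
  have disj: "Lo \<inter> Hi = {}"
  proof -
    have False if lo: "a \<in> Lo" and hi: "a \<in> Hi" for a
    proof -
      obtain s where s: "s \<ge> 0" "W a s < 0" "\<forall>t\<in>{0..s}. W a t < \<Phi> a t" using lo by (auto simp: Lo_def)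
      obtain t where t: "t \<ge> 0" "W a t > \<Phi> a t" "\<forall>u\<in>{0..t}. W a u > 0" using hi by (auto simp: Hi_def)
      \<comment> \<open>Whichever crossing time comes first violates the condition that the other
        set imposes up to its own crossing.\<close>
      from s(1) t(1) have "s \<in> {0..t} \<or> t \<in> {0..s}" by auto
      then show False using s(2,3) t(2,3) by (meson less_asym)
    qed
    then show ?thesis by blast
  qed
  have "openin (top_of_set K) Lo"
  proof -
    have "Lo = (\<Union>s\<in>{0..}. {a \<in> K. - W a s > 0} \<inter> {a \<in> K. \<forall>t\<in>{0..s}. \<Phi> a t - W a t > 0})"
      by (auto simp: Lo_def)
    moreover have "openin (top_of_set K) ({a \<in> K. - W a s > 0} \<inter> {a \<in> K. \<forall>t\<in>{0..s}. \<Phi> a t - W a t > 0})"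
      if "s \<in> {0..}" for s
      using that \<Phi>[of s] W[of s]
      by (intro openin_Int openin_pos openin_uniformly_positive K)
        (auto intro!: continuous_intros at simp: case_prod_unfold)
    ultimately show ?thesis by auto
  qed
  moreover have "openin (top_of_set K) Hi"
  proof -
    have "Hi = (\<Union>s\<in>{0..}. {a \<in> K. W a s - \<Phi> a s > 0} \<inter> {a \<in> K. \<forall>t\<in>{0..s}. W a t > 0})"
      by (auto simp: Hi_def)
    moreover have "openin (top_of_set K) ({a \<in> K. W a s - \<Phi> a s > 0} \<inter> {a \<in> K. \<forall>t\<in>{0..s}. W a t > 0})"
      if "s \<in> {0..}" for s
      using that W[of s]
      by (intro openin_Int openin_pos openin_uniformly_positive K)
        (auto intro!: continuous_intros at simp: case_prod_unfold)
    ultimately show ?thesis by auto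
  qed
  \<comment> \<open>Both endpoint trajectories start on a wall, so \<open>exit\<close> applies at
    time 0 with an empty past. The wrong set is excluded because it requires the strict inequality
    already at time 0.\<close>
  moreover have "\<phi>0 \<in> Lo"
  proof -
    have mem: "\<phi>0 \<in> K" using y_min_less by (simp add: K_def)
    then have 0: "W \<phi>0 0 = 0" "\<Phi> \<phi>0 0 = \<phi>0" using flow_0[OF flow[OF mem]] by auto
    then have "\<phi>0 \<notin> Hi" by (force simp: Hi_def)
    then show ?thesis using exit[OF mem order.refl _ disjI1[OF 0(1)]] by auto
  qed
  moreover have "y_min \<in> Hi"
  proof -
    have mem: "y_min \<in> K" using y_min_less by (simp add: K_def)
    have "(1 - \<Lambda>) * (\<phi>0 - y_min) = \<phi>0" using \<Lambda> by (simp add: y_min_def field_simps)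
    then have 0: "W y_min 0 = \<phi>0" "\<Phi> y_min 0 = \<phi>0" using flow_0[OF flow[OF mem]] by auto
    then have "y_min \<notin> Lo" by (force simp: Lo_def)
    then show ?thesis using exit[OF mem order.refl _ disjI2[OF trans[OF 0(1) 0(2)[symmetric]]]] by auto
  qed
  moreover have "connected K" by (simp add: K_def)
  ultimately have "\<not> K \<subseteq> Lo \<union> Hi"
    using disj unfolding connected_openin by blast
  then obtain a where a: "a \<in> K" "a \<notin> Lo \<union> Hi" by blast
  have good: "0 < W a s \<and> W a s < \<Phi> a s" if "s \<ge> 0" for s
  proof (rule ccontr)
    assume "\<not> ?thesis"
    from flow_first_exit[OF flow[OF a(1)] _ slice[OF a(1)] that this] a
    obtain t where "t \<ge> 0" "\<And>u. 0 \<le> u \<Longrightarrow> u < t \<Longrightarrow> 0 < W a u \<and> W a u < \<Phi> a u" "W a t = 0 \<or> W a t = \<Phi> a t"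
      unfolding K_def by blast
    then show False using exit[OF a(1)] a(2) by blast
  qed
  have "a \<noteq> y_min" "a \<noteq> \<phi>0"
    using a \<open>y_min \<in> Hi\<close> \<open>\<phi>0 \<in> Lo\<close> by auto
  then show thesis
    using that[of a "\<Phi> a" "W a"] a(1) flow[OF a(1)] good by (auto simp: K_def)
qed

section \<open>The free-boundary system\<close>

text \<open>The system written with k and \<Lambda>, the bracket brought over the denominator k y;
  \<open>iff\<close> in the last proof identifies it with \<open>system_solution\<close>.\<close>

definition solution :: "real \<Rightarrow> (real \<Rightarrow> real) \<Rightarrow> (real \<Rightarrow> real) \<Rightarrow> bool" where
  "solution a \<phi> \<psi> \<longleftrightarrow>
     a \<in> {y_min<..<\<phi>0} \<and> \<phi> \<in> {0<..a} \<rightarrow> {0<..\<phi>0} \<and> strict_mono_on {0<..a} \<phi> \<and> \<psi> \<in> {0<..a} \<rightarrow> {0<..<1} \<and>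
     (\<forall>y\<in>{0<..a}.
        (\<phi> has_real_derivative \<phi> y * (1 - \<psi> y) / y) (at y within {0<..a}) \<and>
        (\<psi> has_real_derivative - ((1 - \<psi> y) * (k * \<psi> y + (r + \<rho> - \<delta>) - \<rho> * (\<alpha> + I (\<phi> y)))
           + \<delta> - (r + \<rho>) * y / \<phi> y) / (k * y)) (at y within {0<..a})) \<and>
     \<phi> a = \<phi>0 \<and> \<psi> a = (1 - \<Lambda>) * (\<phi>0 - a) / \<phi>0"

text \<open>The shooting trajectory read in y = a exp (- s). The right derivative at s = 0 becomes
  the left derivative at y = a.\<close>

lemma solution_exists: "\<exists>a \<phi> \<psi>. solution a \<phi> \<psi>"
proof -
  obtain a \<Phi> W where a: "y_min < a" "a < \<phi>0" and flow: "flow a \<Phi> W"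
    and good: "\<And>s. s \<ge> 0 \<Longrightarrow> 0 < W s \<and> W s < \<Phi> s"
    using shooting by blast
  have a0: "a > 0" using a y_min_pos by simp
  have pos: "\<Phi> s > 0" if "s \<ge> 0" for s using good[OF that] by linarith
  have less: "\<Phi> t < \<Phi> s" if "0 \<le> s" "s < t" for s t
    using \<Phi>_less[OF flow that] good that by auto
  have le: "\<Phi> s \<le> \<phi>0" if "s \<ge> 0" for s
    using less[of 0 s] that flow_0[OF flow] by (cases "s = 0") auto
  have D\<Phi>: "(\<Phi> has_real_derivative - \<Phi> s + W s) (at s within {0..})" if "s \<ge> 0" for s
    by (rule deriv_\<Phi>[OF flow that])
  have DW: "(W has_real_derivative rate a s (\<Phi> s) (W s)) (at s within {0..})" if "s \<ge> 0" for s
  proof (rule deriv_W[OF flow that])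
    have "\<phi>0 * exp (- s) \<le> \<Phi> s" using good by (intro \<Phi>_lower[OF flow that]) (auto intro: less_imp_le)
    moreover have "\<phi>0 * exp (- s) > 0" using \<phi>0 by simp
    ultimately show "\<phi>0 * exp (- s) / 2 < \<Phi> s" by linarith
  qed
  define L where "L = (\<lambda>y. ln (a / y))"
  have L0: "L y \<ge> 0" if "y \<in> {0<..a}" for y using that by (simp add: L_def)
  have exp_L: "a * exp (- L y) = y" if "y \<in> {0<..a}" for y
    using that a0 by (simp add: L_def exp_minus)
  have DL: "(L has_real_derivative - 1 / y) (at y within {0<..a})" if "y \<in> {0<..a}" for y
    unfolding L_def using that a0 by (auto intro!: derivative_eq_intros simp: field_simps)
  have L_sub: "L ` {0<..a} \<subseteq> {0..}" using L0 by auto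
  define \<phi> where "\<phi> = (\<lambda>y. \<Phi> (L y))"
  define \<psi> where "\<psi> = (\<lambda>y. W (L y) / \<Phi> (L y))"
  have "solution a \<phi> \<psi>"
    unfolding solution_def
  proof (intro conjI ballI)
    show "a \<in> {y_min<..<\<phi>0}" using a by simp
    show "\<phi> \<in> {0<..a} \<rightarrow> {0<..\<phi>0}" using pos le L0 by (auto simp: \<phi>_def)
    show "strict_mono_on {0<..a} \<phi>"
    proof (rule strict_mono_onI)
      fix x y assume xy: "x \<in> {0<..a}" "y \<in> {0<..a}" "x < y"
      then have "a / y < a / x" using a0 by (intro divide_strict_left_mono) auto
      then have "L y < L x" using xy a0 by (simp add: L_def)
      then show "\<phi> x < \<phi> y" unfolding \<phi>_def using L0[OF xy(2)] by (intro less) auto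
    qed
    show "\<psi> \<in> {0<..a} \<rightarrow> {0<..<1}"
    proof
      fix y assume "y \<in> {0<..a}"
      from good[OF L0[OF this]] pos[OF L0[OF this]] show "\<psi> y \<in> {0<..<1}" by (simp add: \<psi>_def)
    qed
    show "\<phi> a = \<phi>0" "\<psi> a = (1 - \<Lambda>) * (\<phi>0 - a) / \<phi>0"
      using a0 flow_0[OF flow] by (simp_all add: \<phi>_def \<psi>_def L_def)
  next
    fix y assume y: "y \<in> {0<..a}"
    note Ly = L0[OF y]
    have "(\<phi> has_real_derivative (- \<Phi> (L y) + W (L y)) * (- 1 / y)) (at y within {0<..a})"
      unfolding \<phi>_def by (rule DERIV_chain_subset[OF D\<Phi>[OF Ly] DL[OF y] L_sub])
    also have "(- \<Phi> (L y) + W (L y)) * (- 1 / y) = \<phi> y * (1 - \<psi> y) / y"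
      using pos[OF Ly] by (simp add: \<phi>_def \<psi>_def right_diff_distrib diff_divide_distrib)
    finally show "(\<phi> has_real_derivative \<phi> y * (1 - \<psi> y) / y) (at y within {0<..a})" .
    have DP: "((\<lambda>s. W s / \<Phi> s) has_real_derivative
         (rate a (L y) (\<Phi> (L y)) (W (L y)) * \<Phi> (L y) - W (L y) * (- \<Phi> (L y) + W (L y))) / (\<Phi> (L y) * \<Phi> (L y)))
         (at (L y) within {0..})"
      using pos[OF Ly] by (intro DERIV_divide D\<Phi>[OF Ly] DW[OF Ly]) auto
    have "(\<psi> has_real_derivative
       (rate a (L y) (\<Phi> (L y)) (W (L y)) * \<Phi> (L y) - W (L y) * (- \<Phi> (L y) + W (L y))) / (\<Phi> (L y) * \<Phi> (L y)) * (- 1 / y))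
       (at y within {0<..a})"
      unfolding \<psi>_def by (rule DERIV_chain_subset[OF DP DL[OF y] L_sub])
    also have "(rate a (L y) (\<Phi> (L y)) (W (L y)) * \<Phi> (L y) - W (L y) * (- \<Phi> (L y) + W (L y))) / (\<Phi> (L y) * \<Phi> (L y)) * (- 1 / y)
      = - ((1 - \<psi> y) * (k * \<psi> y + (r + \<rho> - \<delta>) - \<rho> * (\<alpha> + I (\<phi> y))) + \<delta> - (r + \<rho>) * y / \<phi> y) / (k * y)"
    proof -
      define p where "p = \<Phi> (L y)"
      define w where "w = W (L y)"
      define j where "j = \<alpha> + I p"
      have "J p = j" using le[OF Ly] by (simp add: J_def j_def p_def min_def)
      then have R: "rate a (L y) p w = ((p - w) * (r + \<rho> - \<delta> - \<rho> * j) + \<delta> * p - (r + \<rho>) * y) / k"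
        by (simp add: rate_def exp_L[OF y])
      have p: "p > 0" "y > 0" using pos[OF Ly] y by (auto simp: p_def)
      have "(rate a (L y) p w * p - w * (- p + w)) / (p * p)
         = ((1 - w / p) * (k * (w / p) + (r + \<rho> - \<delta>) - \<rho> * j) + \<delta> - (r + \<rho>) * y / p) / k"
        unfolding R using p k by (simp add: divide_simps) (simp add: algebra_simps)
      then have "(rate a (L y) p w * p - w * (- p + w)) / (p * p) * (- 1 / y)
         = ((1 - w / p) * (k * (w / p) + (r + \<rho> - \<delta>) - \<rho> * j) + \<delta> - (r + \<rho>) * y / p) / k * (- 1 / y)"
        by simp
      also have "\<dots> = - ((1 - w / p) * (k * (w / p) + (r + \<rho> - \<delta>) - \<rho> * j) + \<delta> - (r + \<rho>) * y / p) / (k * y)"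
        by (simp add: diff_divide_distrib)
      finally show ?thesis by (simp add: p_def w_def j_def \<phi>_def \<psi>_def)
    qed
    finally show "(\<psi> has_real_derivative - ((1 - \<psi> y) * (k * \<psi> y + (r + \<rho> - \<delta>) - \<rho> * (\<alpha> + I (\<phi> y)))
           + \<delta> - (r + \<rho>) * y / \<phi> y) / (k * y)) (at y within {0<..a})" .
  qed
  then show ?thesis by blast
qed

definition dual_value :: "(real \<Rightarrow> real) \<Rightarrow> (real \<Rightarrow> real) \<Rightarrow> real \<Rightarrow> real" where
  "dual_value \<phi> \<psi> y =
     1 / \<delta> * (k / \<rho> * \<phi> y * \<psi> y + G (\<phi> y) + (\<delta> - r - \<rho>) / \<rho> * (y - \<phi> y))"

section \<open>Consequences for an arbitrary solution of the system\<close>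

context
  fixes a :: real and \<phi> \<psi> :: "real \<Rightarrow> real"
  assumes solution: "solution a \<phi> \<psi>"
begin

abbreviation "u \<equiv> dual_value \<phi> \<psi>"

lemma a_pos: "a > 0" and a_less: "a < \<phi>0"
  using solution y_min_pos unfolding solution_def by auto

lemma \<phi>_pos: "y \<in> {0<..a} \<Longrightarrow> \<phi> y > 0" and \<phi>_le: "y \<in> {0<..a} \<Longrightarrow> \<phi> y \<le> \<phi>0"
  and \<psi>_pos: "y \<in> {0<..a} \<Longrightarrow> \<psi> y > 0" and \<psi>_less: "y \<in> {0<..a} \<Longrightarrow> \<psi> y < 1"
  and \<phi>_mono: "x \<in> {0<..a} \<Longrightarrow> y \<in> {0<..a} \<Longrightarrow> x < y \<Longrightarrow> \<phi> x < \<phi> y"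
  and \<phi>_a: "\<phi> a = \<phi>0" and \<psi>_a: "\<psi> a = (1 - \<Lambda>) * (\<phi>0 - a) / \<phi>0"
  using solution unfolding solution_def by (auto simp: Pi_iff strict_mono_on_def)

lemma deriv_\<phi>: "y \<in> {0<..a} \<Longrightarrow> (\<phi> has_real_derivative \<phi> y * (1 - \<psi> y) / y) (at y within {0<..a})"
  and deriv_\<psi>: "y \<in> {0<..a} \<Longrightarrow> (\<psi> has_real_derivative
      - ((1 - \<psi> y) * (k * \<psi> y + (r + \<rho> - \<delta>) - \<rho> * (\<alpha> + I (\<phi> y))) + \<delta> - (r + \<rho>) * y / \<phi> y) / (k * y))
      (at y within {0<..a})"
  using solution unfolding solution_def by auto

lemma deriv_ratio:
  assumes y: "y \<in> {0<..a}"
  shows "((\<lambda>y. \<phi> y / y) has_real_derivative - (\<phi> y * \<psi> y / y\<^sup>2)) (at y within {0<..a})"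
proof -
  have "((\<lambda>y. \<phi> y / y) has_real_derivative (\<phi> y * (1 - \<psi> y) / y * y - \<phi> y * 1) / (y * y)) (at y within {0<..a})"
    using y by (intro DERIV_divide deriv_\<phi> DERIV_ident) auto
  also have "(\<phi> y * (1 - \<psi> y) / y * y - \<phi> y * 1) / (y * y) = - (\<phi> y * \<psi> y / y\<^sup>2)"
    using y by (simp add: power2_eq_square field_simps)
  finally show ?thesis .
qed

lemma ratio_antimono:
  assumes "0 < x" "x < y" "y \<le> a"
  shows "\<phi> y / y < \<phi> x / x"
proof (rule DERIV_neg_imp_decreasing_open[OF assms(2)])
  show "\<exists>D. ((\<lambda>y. \<phi> y / y) has_real_derivative D) (at t) \<and> D < 0" if t: "x < t" "t < y" for t
  proof (intro exI conjI)
    have t': "t \<in> {0<..a}" "0 < t" "t < a" using t assms by auto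
    show "((\<lambda>y. \<phi> y / y) has_real_derivative - (\<phi> t * \<psi> t / t\<^sup>2)) (at t)"
      using deriv_ratio[OF t'(1)] at_within_Ioc[OF t'(2,3)] by simp
    show "- (\<phi> t * \<psi> t / t\<^sup>2) < 0" using \<phi>_pos[OF t'(1)] \<psi>_pos[OF t'(1)] t' by simp
  qed
  have "continuous_on {0<..a} (\<lambda>y. \<phi> y / y)"
    by (rule DERIV_continuous_on, rule deriv_ratio) simp
  then show "continuous_on {x..y} (\<lambda>y. \<phi> y / y)"
    by (rule continuous_on_subset) (use assms in auto)
qed

text \<open>\<phi> y / y decreases in y and still exceeds 1 at a, because a < \<phi>0.\<close>

lemma less_\<phi>:
  assumes y: "y \<in> {0<..a}"
  shows "y < \<phi> y"
proof -
  have 1: "1 < \<phi> a / a" using a_pos a_less by (simp add: \<phi>_a)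
  moreover have "\<phi> a / a \<le> \<phi> y / y" using ratio_antimono[of y a] y by (cases "y = a") auto
  ultimately have "1 < \<phi> y / y" by linarith
  then show ?thesis using y by simp
qed

text \<open>If \<psi> were at most c < 1 at a sufficiently small y1, then in the time s = ln (a / y)
  it would fall with slope at most -1 as long as it stays below c, and so become negative.\<close>

lemma \<psi>_tendsto_1:
  assumes \<phi>: "(\<phi> \<longlongrightarrow> 0) (at_right 0)"
  shows "(\<psi> \<longlongrightarrow> 1) (at_right 0)"
proof (rule order_tendstoI)
  fix c :: real assume "1 < c"
  have "\<psi> y < c" if "y \<in> {0<..<a}" for y using \<psi>_less[of y] that \<open>1 < c\<close> by simp
  then show "\<forall>\<^sub>F y in at_right 0. \<psi> y < c"
    using a_pos by (intro eventually_at_rightI[of 0 a]) auto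
next
  fix c :: real assume c: "c < 1"
  \<comment> \<open>Chosen backwards: I \<ge> Z makes the factor of 1 - \<psi> at most - (\<delta> +
    k) / (1 - c). As 1 - \<psi> \<ge> 1 - c, the product is at most - (\<delta> + k), which absorbs
    \<delta> and leaves slope -1 after division by k.\<close>
  define Z where "Z = (k + \<bar>r + \<rho> - \<delta>\<bar> + (\<delta> + k) / (1 - c)) / \<rho>"
  have "\<forall>\<^sub>F y in at_right 0. \<phi> y \<in> {0<..} \<and> \<phi> y \<noteq> 0"
    using \<phi>_pos by (intro eventually_at_rightI[OF _ a_pos]) (auto simp: less_imp_neq[symmetric])
  with \<phi> have "filterlim \<phi> (at_right 0) (at_right 0)"
    by (simp add: filterlim_at)
  from filterlim_compose[OF I_at_0 this] have "\<forall>\<^sub>F y in at_right 0. Z \<le> I (\<phi> y)"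
    by (simp add: filterlim_at_top)
  then obtain \<eta> where \<eta>: "\<eta> > 0" "\<And>y. 0 < y \<Longrightarrow> y < \<eta> \<Longrightarrow> Z \<le> I (\<phi> y)"
    by (auto simp: eventually_at_right_field)
  have "\<psi> y1 > c" if y1: "0 < y1" "y1 < min \<eta> a" for y1
  proof (rule ccontr)
    assume nc: "\<not> \<psi> y1 > c"
    define q where "q = (\<lambda>s. \<psi> (a * exp (- s)))"
    define s1 where "s1 = ln (a / y1)"
    have s1: "s1 \<ge> 0" "a * exp (- s1) = y1"
      using y1 a_pos by (simp_all add: s1_def exp_minus)
    have mem: "a * exp (- s) \<in> {0<..a}" if "s \<ge> 0" for s
      using a_pos that by (simp add: mult_le_cancel_left1)
    have dq: "\<exists>D\<le>-1. (q has_real_derivative D) (at s within {0..})" if s: "s \<ge> s1" "q s \<le> c" for s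
    proof -
      define y where "y = a * exp (- s)"
      have y: "y \<in> {0<..a}" unfolding y_def using s s1 by (intro mem) simp
      have "y \<le> y1" unfolding y_def s1(2)[symmetric] using s a_pos by simp
      then have Iy: "Z \<le> I (\<phi> y)" using \<eta>(2)[of y] y y1 by simp
      let ?E = "(1 - \<psi> y) * (k * \<psi> y + (r + \<rho> - \<delta>) - \<rho> * (\<alpha> + I (\<phi> y))) + \<delta> - (r + \<rho>) * y / \<phi> y"
      have "(q has_real_derivative - ?E / (k * y) * (a * (exp (- s) * - 1))) (at s within {0..})"
        unfolding q_def
      proof (rule DERIV_chain_subset[where f = \<psi> and g = "\<lambda>s. a * exp (- s)" and T = "{0<..a}"])
        show "(\<psi> has_real_derivative - ?E / (k * y)) (at (a * exp (- s)) within {0<..a})"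
          using deriv_\<psi>[OF y] by (simp add: y_def)
        show "((\<lambda>s. a * exp (- s)) has_real_derivative a * (exp (- s) * - 1)) (at s within {0..})"
          by (auto intro!: derivative_eq_intros)
        show "(\<lambda>s. a * exp (- s)) ` {0..} \<subseteq> {0<..a}" using mem by auto
      qed
      also have "- ?E / (k * y) * (a * (exp (- s) * - 1)) = - ?E / (k * y) * (y * - 1)"
        by (simp only: y_def mult.assoc)
      also have "\<dots> = ?E / k"
      proof -
        have "- e / (k * y) * (y * - 1) = e / k" for e :: real using y k by simp
        then show ?thesis .
      qed
      finally have D: "(q has_real_derivative ?E / k) (at s within {0..})" .
      have \<psi>: "\<psi> y \<le> c" using s by (simp add: q_def y_def)
      have Z: "\<rho> * Z = k + \<bar>r + \<rho> - \<delta>\<bar> + (\<delta> + k) / (1 - c)" using \<rho> by (simp add: Z_def)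
      have nonneg: "(\<delta> + k) / (1 - c) \<ge> 0" using \<delta> k c by simp
      have "k * \<psi> y + (r + \<rho> - \<delta>) - \<rho> * (\<alpha> + I (\<phi> y)) \<le> k + \<bar>r + \<rho> - \<delta>\<bar> - \<rho> * Z"
      proof -
        have "k * \<psi> y \<le> k" using \<psi>_less[OF y] k by simp
        moreover have "\<rho> * Z \<le> \<rho> * (\<alpha> + I (\<phi> y))" using Iy \<rho> \<alpha> by simp
        ultimately show ?thesis by linarith
      qed
      also have "\<dots> = - ((\<delta> + k) / (1 - c))" using Z by simp
      finally have X: "k * \<psi> y + (r + \<rho> - \<delta>) - \<rho> * (\<alpha> + I (\<phi> y)) \<le> - ((\<delta> + k) / (1 - c))" .
      have "(1 - \<psi> y) * (k * \<psi> y + (r + \<rho> - \<delta>) - \<rho> * (\<alpha> + I (\<phi> y))) \<le> (1 - \<psi> y) * - ((\<delta> + k) / (1 - c))"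
        using X \<psi>_less[OF y] by (intro mult_left_mono) auto
      also have "\<dots> \<le> (1 - c) * - ((\<delta> + k) / (1 - c))"
        using \<psi> nonneg by (intro mult_right_mono_neg) auto
      also have "\<dots> = - (\<delta> + k)" using c by simp
      finally have "(1 - \<psi> y) * (k * \<psi> y + (r + \<rho> - \<delta>) - \<rho> * (\<alpha> + I (\<phi> y))) \<le> - (\<delta> + k)" .
      moreover have "(r + \<rho>) * y / \<phi> y \<ge> 0" using y \<phi>_pos[OF y] r \<rho> by simp
      ultimately have "?E \<le> - k" by linarith
      then have "?E / k \<le> -1" using k by (simp add: divide_le_eq)
      then show ?thesis using D by blast
    qed
    \<comment> \<open>The added slope 1/2 keeps g strictly decreasing wherever q \<le> c, so a
      minimum on the window cannot lie before its end. At the end the added term is 1 > c, and q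
      would be negative.\<close>
    define g where "g = (\<lambda>s. q s + (s - s1) / 2)"
    have cont: "continuous_on {0<..a} \<psi>" by (rule DERIV_continuous_on, rule deriv_\<psi>) simp
    have sub: "(\<lambda>s. a * exp (- s)) ` {s1..s1+2} \<subseteq> {0<..a}"
      by (intro image_subsetI mem) (use s1(1) in simp)
    have "continuous_on {s1..s1+2} (\<lambda>s. \<psi> (a * exp (- s)))"
      by (rule continuous_on_compose2[OF cont _ sub]) (intro continuous_intros)
    then have "continuous_on {s1..s1+2} g"
      unfolding g_def q_def by (intro continuous_intros) auto
    then obtain m where m: "m \<in> {s1..s1+2}" "\<And>s. s \<in> {s1..s1+2} \<Longrightarrow> g m \<le> g s"
      using continuous_attains_inf[of "{s1..s1+2}" g] by auto
    have "g s1 \<le> c" using nc by (simp add: g_def q_def s1)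
    then have gm: "g m \<le> c" using m(2)[of s1] by simp
    show False
    proof (cases "m = s1 + 2")
      case True
      have "q m > 0" unfolding q_def using mem[of m] m s1 by (intro \<psi>_pos) auto
      then show False using gm c True by (simp add: g_def)
    next
      case False
      have "(m - s1) / 2 \<ge> 0" using m(1) by simp
      then have "q m \<le> c" using gm unfolding g_def by linarith
      then obtain D where D: "D \<le> -1" "(q has_real_derivative D) (at m within {0..})" using dq[of m] m by auto
      have "(g has_real_derivative D + 1 / 2) (at m within {0..})"
        unfolding g_def using D(2) by (auto intro!: derivative_eq_intros)
      then obtain d where d: "d > 0" "\<And>h. 0 < h \<Longrightarrow> m + h \<in> {0..} \<Longrightarrow> h < d \<Longrightarrow> g (m + h) < g m"
        using has_real_derivative_neg_dec_right[of g "D + 1/2" m "{0..}"] D(1) by auto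
      have "0 < min d (s1 + 2 - m)" using d(1) m(1) False by auto
      from dense[OF this] obtain h where "0 < h" "h < d" "h < s1 + 2 - m" by auto
      moreover from this have "m + h \<in> {s1..s1+2}" using m(1) by simp
      ultimately show False using d(2)[of h] m(2)[of "m + h"] s1 by auto
    qed
  qed
  then show "\<forall>\<^sub>F y in at_right 0. c < \<psi> y"
    using \<eta>(1) a_pos by (intro eventually_at_rightI[of 0 "min \<eta> a"]) auto
qed

text \<open>The limit of the increasing \<phi> is its infimum; if that is 0,
  \<open>\<psi>_tendsto_1\<close> applies.\<close>

lemma solution_limit: "(\<exists>l>0. (\<phi> \<longlongrightarrow> l) (at_right 0)) \<or> (\<psi> \<longlongrightarrow> 1) (at_right 0)"
proof -
  define l where "l = Inf (\<phi> ` {0<..a})"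
  have ne: "\<phi> ` {0<..a} \<noteq> {}" using a_pos by auto
  have bdd: "bdd_below (\<phi> ` {0<..a})" using \<phi>_pos by (intro bdd_belowI[of _ 0]) (auto intro: less_imp_le)
  have l: "l \<ge> 0" unfolding l_def using \<phi>_pos ne by (intro cInf_greatest) (auto intro: less_imp_le)
  have "(\<phi> \<longlongrightarrow> l) (at_right 0)"
  proof (rule order_tendstoI)
    fix c assume "c < l"
    have "c < \<phi> y" if "y \<in> {0<..<a}" for y
    proof -
      have "l \<le> \<phi> y" unfolding l_def using that by (intro cInf_lower bdd imageI) auto
      with \<open>c < l\<close> show ?thesis by linarith
    qed
    then show "\<forall>\<^sub>F y in at_right 0. c < \<phi> y"
      using a_pos by (intro eventually_at_rightI[of 0 a]) auto
  next
    fix c assume "l < c"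
    then obtain x where x: "x \<in> {0<..a}" "\<phi> x < c" using cInf_lessD[OF ne, of c] by (auto simp: l_def)
    then have "\<phi> y < c" if "y \<in> {0<..<x}" for y using \<phi>_mono[of y x] that by auto
    then show "\<forall>\<^sub>F y in at_right 0. \<phi> y < c"
      using x by (intro eventually_at_rightI[of 0 x]) auto
  qed
  then show ?thesis using l \<psi>_tendsto_1 by (cases "l = 0") (auto intro!: exI[of _ l])
qed

text \<open>A bound Z on \<phi> y / y forces \<phi> to 0 and hence \<psi> above 1/2 near 0. With
  \<phi> > y the ratio then has derivative at most - 1 / (2 y), so it grows at least like - ln y /
  2, contradicting the bound.\<close>

lemma ratio_at_0: "filterlim (\<lambda>y. \<phi> y / y) at_top (at_right 0)"
  unfolding filterlim_at_top_gt[of _ _ 0]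
proof (intro allI impI)
  fix Z :: real assume Z: "Z > 0"
  have "\<exists>x\<in>{0<..a}. Z \<le> \<phi> x / x"
  proof (rule ccontr)
    assume "\<not> ?thesis"
    then have bd: "\<phi> x / x < Z" if "x \<in> {0<..a}" for x
      using that by (meson not_le)
    have le: "\<phi> y \<le> Z * y" "0 \<le> \<phi> y" if "y \<in> {0<..<a}" for y
    proof -
      have y: "y \<in> {0<..a}" "y > 0" using that by auto
      show "\<phi> y \<le> Z * y" using bd[OF y(1)] y(2) by (simp add: pos_divide_less_eq)
      show "0 \<le> \<phi> y" using \<phi>_pos[OF y(1)] by simp
    qed
    have "(\<phi> \<longlongrightarrow> 0) (at_right 0)"
    proof (rule tendsto_sandwich)
      show "\<forall>\<^sub>F y in at_right 0. 0 \<le> \<phi> y"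
        by (rule eventually_at_rightI[OF le(2) a_pos])
      show "\<forall>\<^sub>F y in at_right 0. \<phi> y \<le> Z * y"
        by (rule eventually_at_rightI[OF le(1) a_pos])
      show "((*) Z \<longlongrightarrow> 0) (at_right 0)" by (auto intro!: tendsto_eq_intros)
    qed simp
    then have "\<forall>\<^sub>F y in at_right 0. 1 / 2 < \<psi> y"
      using order_tendstoD(1)[OF \<psi>_tendsto_1, of "1 / 2"] by simp
    then obtain \<eta> where \<eta>: "\<eta> > 0" "\<And>y. 0 < y \<Longrightarrow> y < \<eta> \<Longrightarrow> 1 / 2 < \<psi> y"
      by (auto simp: eventually_at_right_field)
    define y1 where "y1 = min \<eta> a / 2"
    have y1: "0 < y1" "y1 < \<eta>" "y1 < a" using \<eta>(1) a_pos by (auto simp: y1_def)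
    \<comment> \<open>Moving down by the factor exp (- 2 Z) raises the ratio by at least Z, above
      its positive value at y1.\<close>
    define x where "x = y1 * exp (- (2 * Z))"
    have x: "0 < x" "x < y1" using y1 Z by (auto simp: x_def)
    have "\<phi> y1 / y1 + ln y1 / 2 \<le> \<phi> x / x + ln x / 2"
    proof (rule DERIV_nonpos_imp_decreasing_open[OF less_imp_le[OF x(2)]])
      fix t assume t: "x < t" "t < y1"
      then have t': "t \<in> {0<..a}" "0 < t" "t < a" using x y1 by auto
      have "((\<lambda>y. \<phi> y / y + ln y / 2) has_real_derivative - (\<phi> t * \<psi> t / t\<^sup>2) + 1 / t / 2) (at t)"
        using deriv_ratio[OF t'(1)] at_within_Ioc[OF t'(2,3)] DERIV_ln_divide[OF t'(2)]
        by (intro DERIV_add DERIV_cdivide) auto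
      moreover have "t * (1 / 2) \<le> \<phi> t * \<psi> t"
        using less_\<phi>[OF t'(1)] \<eta>(2)[of t] t' t y1 by (intro mult_mono) auto
      then have "- (\<phi> t * \<psi> t / t\<^sup>2) + 1 / t / 2 \<le> 0"
        using t' by (simp add: field_simps power2_eq_square)
      ultimately show "\<exists>D. ((\<lambda>y. \<phi> y / y + ln y / 2) has_real_derivative D) (at t) \<and> D \<le> 0" by blast
    next
      have "continuous_on {0<..a} (\<lambda>y. \<phi> y / y)"
        by (rule DERIV_continuous_on, rule deriv_ratio) simp
      then have "continuous_on {x..y1} (\<lambda>y. \<phi> y / y)"
        by (rule continuous_on_subset) (use x y1 in auto)
      moreover have "continuous_on {x..y1} ln" using x by (intro continuous_on_ln continuous_on_id) auto
      ultimately show "continuous_on {x..y1} (\<lambda>y. \<phi> y / y + ln y / 2)"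
        by (rule continuous_on_add[OF _ continuous_on_divide[OF _ continuous_on_const]]) simp
    qed
    moreover have "ln x = ln y1 - 2 * Z" using y1 by (simp add: x_def ln_mult)
    moreover have "\<phi> y1 / y1 > 0" using \<phi>_pos[of y1] y1 by simp
    ultimately have "Z < \<phi> x / x" by linarith
    then show False using bd[of x] x y1 by auto
  qed
  then obtain x where x: "x \<in> {0<..a}" "Z \<le> \<phi> x / x" by blast
  then have "Z \<le> \<phi> y / y" if "y \<in> {0<..<x}" for y
    using ratio_antimono[of y x] that by auto
  then show "\<forall>\<^sub>F y in at_right 0. Z \<le> \<phi> y / y"
    using x by (intro eventually_at_rightI[of 0 x]) auto
qed

text \<open>Multiplied by \<rho> \<delta>, u is V, whose derivative in s is \<delta> (\<phi> - y);
  dividing by dy/ds = - y gives the claim. In the calculation the terms with I cancel between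
  \<psi>' and G'.\<close>

lemma deriv_u_within:
  assumes y: "y \<in> {0<..a}"
  shows "(u has_real_derivative (y - \<phi> y) / (\<rho> * y)) (at y within {0<..a})"
proof -
  define p where "p = \<phi> y"
  define q where "q = \<psi> y"
  define j where "j = \<alpha> + I p"
  define p' where "p' = p * (1 - q) / y"
  define q' where "q' = - ((1 - q) * (k * q + (r + \<rho> - \<delta>) - \<rho> * j) + \<delta> - (r + \<rho>) * y / p) / (k * y)"
  have p: "p > 0" "y > 0" "p \<le> \<phi>0" using \<phi>_pos[OF y] \<phi>_le[OF y] y by (auto simp: p_def)
  have D: "(\<phi> has_real_derivative p') (at y within {0<..a})" "(\<psi> has_real_derivative q') (at y within {0<..a})"
    using deriv_\<phi>[OF y] deriv_\<psi>[OF y] by (simp_all add: p_def q_def j_def p'_def q'_def)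
  have Jp: "J p = j" using p by (simp add: J_def j_def min_def)
  \<comment> \<open>At y = a the inner value is \<phi>0, the end of the domain of G; the extension
    is differentiable there, and it agrees with G along the solution.\<close>
  have DG: "((\<lambda>y. G_ext (\<phi> y)) has_real_derivative - j * p') (at y within {0<..a})"
    using DERIV_chain2[where g = \<phi> and x = y, OF deriv_G_ext[OF p(1)[unfolded p_def]] D(1)] Jp
    by (simp add: p_def)
  have "((\<lambda>y. 1 / \<delta> * (k / \<rho> * (\<phi> y * \<psi> y) + G_ext (\<phi> y) + (\<delta> - r - \<rho>) / \<rho> * (y - \<phi> y))) has_real_derivative
     1 / \<delta> * (k / \<rho> * (p' * \<psi> y + q' * \<phi> y) + - j * p' + (\<delta> - r - \<rho>) / \<rho> * (1 - p'))) (at y within {0<..a})"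
    by (intro DERIV_cmult DERIV_add DERIV_mult DERIV_diff DERIV_ident D DG)
  also have "1 / \<delta> * (k / \<rho> * (p' * \<psi> y + q' * \<phi> y) + - j * p' + (\<delta> - r - \<rho>) / \<rho> * (1 - p')) = (y - p) / (\<rho> * y)"
  proof -
    have "k * y * q' = - ((1 - q) * (k * q + (r + \<rho> - \<delta>) - \<rho> * j) + \<delta> - (r + \<rho>) * y / p)"
      using p k by (simp add: q'_def)
    then have kq: "k * q' * p * y = - (p * ((1 - q) * (k * q + (r + \<rho> - \<delta>) - \<rho> * j) + \<delta>) - (r + \<rho>) * y)"
      using p by (simp add: field_simps)
    have py: "p' * y = p * (1 - q)" using p by (simp add: p'_def)
    have "y * (k * (p' * q + q' * p) - \<rho> * j * p' + (\<delta> - r - \<rho>) * (1 - p'))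
       = k * q * (p' * y) + k * q' * p * y - \<rho> * j * (p' * y) + (\<delta> - r - \<rho>) * (y - p' * y)"
      by (simp add: algebra_simps)
    also have "\<dots> = \<delta> * (y - p)"
      unfolding py kq by (simp add: algebra_simps)
    finally have *: "k * (p' * q + q' * p) - \<rho> * j * p' + (\<delta> - r - \<rho>) * (1 - p') = \<delta> * (y - p) / y"
      using p by (simp add: field_simps)
    have gen: "1 / \<delta> * (k / \<rho> * X + - j * Y + B / \<rho> * V) = (k * X - \<rho> * j * Y + B * V) / (\<delta> * \<rho>)"
      for X Y B V :: real
      using \<rho> \<delta> by (simp add: field_simps)
    have "1 / \<delta> * (k / \<rho> * (p' * q + q' * p) + - j * p' + (\<delta> - r - \<rho>) / \<rho> * (1 - p'))
       = (k * (p' * q + q' * p) - \<rho> * j * p' + (\<delta> - r - \<rho>) * (1 - p')) / (\<delta> * \<rho>)"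
      by (rule gen)
    also have "\<dots> = (y - p) / (\<rho> * y)"
      unfolding * using \<delta> by simp
    finally show ?thesis by (simp add: p_def q_def)
  qed
  finally have "((\<lambda>y. 1 / \<delta> * (k / \<rho> * (\<phi> y * \<psi> y) + G_ext (\<phi> y) + (\<delta> - r - \<rho>) / \<rho> * (y - \<phi> y))) has_real_derivative
     (y - \<phi> y) / (\<rho> * y)) (at y within {0<..a})" by (simp add: p_def)
  then show ?thesis
  proof (rule has_field_derivative_transform_within[OF _ zero_less_one y])
    show "1 / \<delta> * (k / \<rho> * (\<phi> x * \<psi> x) + G_ext (\<phi> x) + (\<delta> - r - \<rho>) / \<rho> * (x - \<phi> x)) = u x"
      if "x \<in> {0<..a}" for x
      using \<phi>_le[OF that] by (simp add: dual_value_def G_ext_def min_def mult.assoc)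
  qed
qed

lemma deriv2_u_within:
  assumes y: "y \<in> {0<..a}"
  shows "((\<lambda>y. (y - \<phi> y) / (\<rho> * y)) has_real_derivative 1 / (\<rho> * y\<^sup>2) * \<phi> y * \<psi> y) (at y within {0<..a})"
proof -
  have "((\<lambda>y. (1 - \<phi> y / y) / \<rho>) has_real_derivative (0 - - (\<phi> y * \<psi> y / y\<^sup>2)) / \<rho>) (at y within {0<..a})"
    by (intro DERIV_cdivide DERIV_diff DERIV_const deriv_ratio y)
  also have "(0 - - (\<phi> y * \<psi> y / y\<^sup>2)) / \<rho> = 1 / (\<rho> * y\<^sup>2) * \<phi> y * \<psi> y" by simp
  finally show ?thesis
    by (rule has_field_derivative_transform_within[OF _ zero_less_one y])
      (use \<rho> in \<open>auto simp: field_simps\<close>)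
qed

lemma u_ode:
  assumes y: "y \<in> {0<..a}"
  shows "k * y\<^sup>2 * (1 / (\<rho> * y\<^sup>2) * \<phi> y * \<psi> y) + G (y - \<rho> * y * ((y - \<phi> y) / (\<rho> * y)))
    + (\<delta> - r - \<rho>) * y * ((y - \<phi> y) / (\<rho> * y)) - \<delta> * u y = 0"
proof -
  have "y - \<rho> * y * ((y - \<phi> y) / (\<rho> * y)) = \<phi> y" using y \<rho> by simp
  then show ?thesis using y \<rho> \<delta> by (simp add: dual_value_def)
qed

lemma u_a: "u a = (a - \<phi>0) / (\<rho> * \<Lambda>) + G \<phi>0 / \<delta>"
proof -
  \<comment> \<open>The characteristic equation divided by \<Lambda>; it converts the prescribed
    \<psi> a into the boundary value of u.\<close>
  have e: "k * (\<Lambda> - 1) - (r + \<rho> - \<delta>) = \<delta> / \<Lambda>"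
    using \<Lambda>_eq \<Lambda> by (simp add: field_simps)
  have "\<delta> * u a = k / \<rho> * \<phi>0 * ((1 - \<Lambda>) * (\<phi>0 - a) / \<phi>0) + G \<phi>0 + (\<delta> - r - \<rho>) / \<rho> * (a - \<phi>0)"
    using \<delta> by (simp add: dual_value_def \<phi>_a \<psi>_a)
  also have "\<dots> = (a - \<phi>0) / \<rho> * (k * (\<Lambda> - 1) - (r + \<rho> - \<delta>)) + G \<phi>0"
    using \<phi>0 by (simp add: algebra_simps diff_divide_distrib add_divide_distrib)
  finally have "\<delta> * u a = \<delta> * ((a - \<phi>0) / (\<rho> * \<Lambda>) + G \<phi>0 / \<delta>)"
    unfolding e using \<delta> by (simp add: distrib_left)
  then show ?thesis using \<delta> by simp
qed

lemma has_derivative_u: "y \<in> {0<..<a} \<Longrightarrow> (u has_real_derivative (y - \<phi> y) / (\<rho> * y)) (at y)"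
  and has_derivative_u': "y \<in> {0<..<a} \<Longrightarrow>
    ((\<lambda>y. (y - \<phi> y) / (\<rho> * y)) has_real_derivative 1 / (\<rho> * y\<^sup>2) * \<phi> y * \<psi> y) (at y)"
  using deriv_u_within[of y] deriv2_u_within[of y] at_within_Ioc[of y a] by auto

lemma deriv_u: "y \<in> {0<..<a} \<Longrightarrow> deriv u y = (y - \<phi> y) / (\<rho> * y)"
  by (rule DERIV_imp_deriv[OF has_derivative_u])

lemma has_derivative_deriv_u:
  assumes "y \<in> {0<..<a}"
  shows "(deriv u has_real_derivative 1 / (\<rho> * y\<^sup>2) * \<phi> y * \<psi> y) (at y)"
  by (rule has_field_derivative_transform_within_open[OF has_derivative_u'[OF assms] _ assms])
    (simp_all add: deriv_u)

lemma strict_antimono_u: "strict_antimono_on {0<..<a} u"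
proof (rule monotone_onI)
  fix x y assume xy: "x \<in> {0<..<a}" "y \<in> {0<..<a}" "x < y"
  show "u x > u y"
  proof (rule DERIV_neg_imp_decreasing[OF xy(3)])
    fix t assume "x \<le> t" "t \<le> y"
    then have t: "t \<in> {0<..<a}" using xy by auto
    then have "(t - \<phi> t) / (\<rho> * t) < 0"
      using less_\<phi>[of t] \<rho> by (intro divide_neg_pos) auto
    then show "\<exists>D. (u has_real_derivative D) (at t) \<and> D < 0"
      using has_derivative_u[OF t] by blast
  qed
qed

lemma convex_on_u: "convex_on {0<..<a} u"
proof (rule f''_ge0_imp_convex[OF _ has_derivative_u has_derivative_u'])
  show "1 / (\<rho> * y\<^sup>2) * \<phi> y * \<psi> y \<ge> 0" if "y \<in> {0<..<a}" for y
    using \<phi>_pos[of y] \<psi>_pos[of y] \<rho> that by simp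
qed auto

lemma deriv_u_at_0: "filterlim (deriv u) at_bot (at_right 0)"
  unfolding filterlim_at_bot
proof
  fix Z :: real
  have "\<forall>\<^sub>F y in at_right 0. 1 - \<rho> * Z \<le> \<phi> y / y"
    using ratio_at_0 by (simp add: filterlim_at_top)
  moreover have "\<forall>\<^sub>F y in at_right 0. y \<in> {0<..<a}"
    by (rule eventually_at_rightI[OF _ a_pos])
  ultimately show "\<forall>\<^sub>F y in at_right 0. deriv u y \<le> Z"
  proof eventually_elim
    case (elim y)
    have "(y - \<phi> y) / (\<rho> * y) = (1 - \<phi> y / y) / \<rho>" using elim \<rho> by (simp add: field_simps)
    also have "\<dots> \<le> Z" using elim \<rho> by (simp add: pos_divide_le_eq mult.commute)
    finally show ?case using deriv_u[of y] elim by simp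
  qed
qed

end

end

section \<open>Return to the original constants\<close>

lemma lam_quadratic:
  fixes r \<mu> \<sigma> \<rho> \<delta> :: real
  assumes "\<mu> > 0" "\<sigma> > 0" "\<delta> > 0"
  defines "k \<equiv> \<mu>\<^sup>2 / (2 * \<sigma>\<^sup>2)" and "l \<equiv> lam r \<mu> \<sigma> \<rho> \<delta>"
  shows "l < 0" and "k * l * (l - 1) = (r + \<rho> - \<delta>) * l + \<delta>"
proof -
  define B where "B = k + r + \<rho> - \<delta>"
  define S where "S = sqrt (B\<^sup>2 + 4 * \<delta> * k)"
  have k: "k > 0" using assms by (simp add: k_def)
  have "\<sigma>\<^sup>2 / \<mu>\<^sup>2 = 1 / (2 * k)" "2 * \<delta> * (\<mu>\<^sup>2 / \<sigma>\<^sup>2) = 4 * \<delta> * k"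
    using assms(1,2) by (simp_all add: k_def)
  then have "l = 1 / (2 * k) * (B - S)"
    by (simp add: l_def lam_def S_def B_def k_def)
  then have l: "2 * k * l = B - S" using k by simp
  have S2: "S\<^sup>2 = B\<^sup>2 + 4 * \<delta> * k" using k assms(3) by (simp add: S_def)
  \<comment> \<open>The radicand exceeds B^2 because \<delta> k > 0, so the root taken with the
    minus sign is negative.\<close>
  have "\<bar>B\<bar> < S"
    unfolding S_def using k assms(3) by (intro real_less_rsqrt) simp
  then have "2 * k * l < 0" using l by simp
  then show "l < 0" using k by (simp add: mult_less_0_iff)
  have "(2 * k * l)\<^sup>2 - 2 * B * (2 * k * l) - 4 * k * \<delta> = 0"
    unfolding l using S2 by (simp add: power2_eq_square algebra_simps)
  then have "4 * k * (k * l * (l - 1)) = 4 * k * ((r + \<rho> - \<delta>) * l + \<delta>)"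
    by (simp add: B_def power2_eq_square algebra_simps)
  then show "k * l * (l - 1) = (r + \<rho> - \<delta>) * l + \<delta>" using k by simp
qed

theorem theorem3p1:
  fixes r \<mu> \<sigma> \<rho> \<delta> \<alpha> :: real and Up Um :: "real \<Rightarrow> real"
  assumes "r \<ge> 0" and "\<mu> > 0" and "\<sigma> > 0" and "\<rho> > 0" and "\<delta> > 0" and "\<alpha> > 0"
    and "Up \<in> utility_class" and "Um \<in> utility_class"
    and A1: "ereal (Um \<alpha>) \<le> ereal \<alpha> * marginal Up 0"
    and A2: "\<exists>a1 a2 a3 a4 :: real. a1 > 0 \<and> a2 > 0 \<and> a3 > 0 \<and> a4 \<ge> 0 \<and>
               (\<forall>x>a3. Up x \<le> a1 + x * deriv Up x + a2 * deriv Up x powr (- a4))"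
  shows "(\<exists>y0 \<phi> \<psi>. system_solution r \<mu> \<sigma> \<rho> \<delta> \<alpha> Up Um y0 \<phi> \<psi> \<and>
            ((\<exists>l>0. (\<phi> \<longlongrightarrow> l) (at_right 0)) \<or> (\<psi> \<longlongrightarrow> 1) (at_right 0))) \<and>
         (\<forall>y0 \<phi> \<psi>. system_solution r \<mu> \<sigma> \<rho> \<delta> \<alpha> Up Um y0 \<phi> \<psi> \<longrightarrow>
            (let u = u_fun r \<mu> \<sigma> \<rho> \<delta> \<alpha> Up \<phi> \<psi> in
               free_boundary_solution r \<mu> \<sigma> \<rho> \<delta> \<alpha> Up Um u y0 \<and>
               (\<forall>y\<in>{0<..<y0}.
                  (u has_real_derivative (y - \<phi> y) / (\<rho> * y)) (at y) \<and>
                  (deriv u has_real_derivative 1 / (\<rho> * y\<^sup>2) * \<phi> y * \<psi> y) (at y)) \<and>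
               strict_antimono_on {0<..<y0} u \<and>
               convex_on {0<..<y0} u \<and>
               filterlim (deriv u) at_bot (at_right 0)))"
proof -
  note pos = assms(1-6)
  have "Um \<alpha> > 0" using utility.U_pos[of Um \<alpha>] assms(6,8) by (simp add: utility_def)
  then interpret U: utility_pair Up Um \<alpha> using assms by unfold_locales auto
  define k where "k = \<mu>\<^sup>2 / (2 * \<sigma>\<^sup>2)"
  define l where "l = lam r \<mu> \<sigma> \<rho> \<delta>"
  define \<phi>0 where "\<phi>0 = phi_zero Up Um \<alpha>"
  have l: "l < 0" "k * l * (l - 1) = (r + \<rho> - \<delta>) * l + \<delta>"
    unfolding k_def l_def by (rule lam_quadratic[OF pos(2,3,5)])+
  interpret dual_system k r \<rho> \<delta> \<alpha> l \<phi>0 "inv_marginal Up" "G_fun Up \<alpha>"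
  proof
    show "k > 0" using pos by (simp add: k_def)
    show "\<phi>0 > 0" unfolding \<phi>0_def by (rule U.phi_zero_pos)
    show "inv_marginal Up p \<ge> 0" if "p \<in> {0<..\<phi>0}" for p
      using U.marginal_I(1) that by (simp add: \<phi>0_def)
    show "continuous_on {0<..\<phi>0} (inv_marginal Up)"
      unfolding \<phi>0_def by (rule U.continuous_on_I)
    show "\<exists>d<0. (inv_marginal Up has_real_derivative d) (at p)" if "p \<in> {0<..<\<phi>0}" for p
      using U.deriv_I that by (simp add: \<phi>0_def)
    show "filterlim (inv_marginal Up) at_top (at_right 0)" by (rule U.I_at_0)
    show "G_fun Up \<alpha> p - (\<alpha> + inv_marginal Up p) * (q - p) \<le> G_fun Up \<alpha> q"
      if "p \<in> {0<..\<phi>0}" "q \<in> {0<..\<phi>0}" for p q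
      using U.G_fun_subgradient that by (simp add: \<phi>0_def)
  qed (use pos l in auto)
  have k': "2 * \<rho> * \<sigma>\<^sup>2 / \<mu>\<^sup>2 = \<rho> / k" "\<mu>\<^sup>2 / (2 * \<rho> * \<sigma>\<^sup>2) = k / \<rho>" "2 * \<sigma>\<^sup>2 / (\<phi>0 * \<mu>\<^sup>2) = 1 / (\<phi>0 * k)"
    using pos by (simp_all add: k_def)
  have rhs: "- (\<rho> / k) * ((1 - q) / y * (k / \<rho> * q - i + (r - \<delta>) / \<rho> + 1 - \<alpha>) - (r + \<rho>) / (\<rho> * p) + \<delta> / (\<rho> * y))
      = - ((1 - q) * (k * q + (r + \<rho> - \<delta>) - \<rho> * (\<alpha> + i)) + \<delta> - (r + \<rho>) * y / p) / (k * y)"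
    if "y > 0" for y p q i :: real
  proof -
    have 1: "k / \<rho> * q - i + (r - \<delta>) / \<rho> + 1 - \<alpha> = (k * q + (r + \<rho> - \<delta>) - \<rho> * (\<alpha> + i)) / \<rho>"
      using \<rho> by (simp add: field_simps)
    have 2: "(1 - q) / y * (X / \<rho>) - (r + \<rho>) / (\<rho> * p) + \<delta> / (\<rho> * y)
        = ((1 - q) * X + \<delta> - (r + \<rho>) * y / p) / (\<rho> * y)" for X
    proof -
      have "(1 - q) / y * (X / \<rho>) = (1 - q) * X / (\<rho> * y)" "(r + \<rho>) / (\<rho> * p) = (r + \<rho>) * y / p / (\<rho> * y)"
        using that \<rho> by simp_all
      then show ?thesis by (simp only: add_divide_distrib diff_divide_distrib)
    qed
    have 3: "- (\<rho> / k) * (E / (\<rho> * y)) = - E / (k * y)" for E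
      using \<rho> by simp
    show ?thesis by (simp only: 1 2 3)
  qed
  have phi': "1 / y * p * (1 - q) = p * (1 - q) / y" for y p q :: real by simp
  \<comment> \<open>By the characteristic equation, the prescribed value of \<psi> at the free
    boundary is W / \<Phi> at s = 0.\<close>
  have psi0: "1 / (\<phi>0 * k) * (\<delta> / l + r + \<rho> - \<delta>) * (y0 - \<phi>0) = (1 - l) * (\<phi>0 - y0) / \<phi>0" for y0
  proof -
    have "\<delta> / l + r + \<rho> - \<delta> = k * (l - 1)" using l by (simp add: field_simps)
    then show ?thesis using k \<phi>0 by (simp only:) (simp add: field_simps)
  qed
  have iff: "system_solution r \<mu> \<sigma> \<rho> \<delta> \<alpha> Up Um y0 \<phi> \<psi> \<longleftrightarrow> solution y0 \<phi> \<psi>" for y0 \<phi> \<psi>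
  proof -
    have pos_y: "y > 0" if "y \<in> {0<..y0}" for y using that by simp
    show ?thesis
      unfolding system_solution_def Let_def l_def[symmetric] \<phi>0_def[symmetric] k' psi0 solution_def y_min_def
      by (simp only: rhs[OF pos_y] phi' cong: ball_cong)
  qed
  have u: "u_fun r \<mu> \<sigma> \<rho> \<delta> \<alpha> Up \<phi> \<psi> = dual_value \<phi> \<psi>" for \<phi> \<psi>
    by (rule ext) (simp only: u_fun_def dual_value_def k')
  have fb: "free_boundary_solution r \<mu> \<sigma> \<rho> \<delta> \<alpha> Up Um (dual_value \<phi> \<psi>) y0" if solution: "solution y0 \<phi> \<psi>" for y0 \<phi> \<psi>
    unfolding free_boundary_solution_def l_def[symmetric] \<phi>0_def[symmetric] k_def[symmetric]
  proof (intro conjI exI ballI)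
    show "0 < y0" by (rule a_pos[OF solution])
    show "dual_value \<phi> \<psi> y0 = (y0 - \<phi>0) / (\<rho> * l) + S_utility Up Um \<alpha> 0 / \<delta>"
      using u_a[OF solution] U.G_fun_phi_zero pos by (simp add: \<phi>0_def S_utility_def)
    show "y0 - \<rho> * y0 * ((y0 - \<phi> y0) / (\<rho> * y0)) = \<phi>0"
      using a_pos[OF solution] \<phi>_a[OF solution] \<rho> by simp
  next
    fix y assume y: "y \<in> {0<..y0}"
    show "(dual_value \<phi> \<psi> has_real_derivative (y - \<phi> y) / (\<rho> * y)) (at y within {0<..y0})"
      by (rule deriv_u_within[OF solution y])
    show "((\<lambda>y. (y - \<phi> y) / (\<rho> * y)) has_real_derivative 1 / (\<rho> * y\<^sup>2) * \<phi> y * \<psi> y) (at y within {0<..y0})"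
      by (rule deriv2_u_within[OF solution y])
    show "k * y\<^sup>2 * (1 / (\<rho> * y\<^sup>2) * \<phi> y * \<psi> y) + G_fun Up \<alpha> (y - \<rho> * y * ((y - \<phi> y) / (\<rho> * y)))
        + (\<delta> - r - \<rho>) * y * ((y - \<phi> y) / (\<rho> * y)) - \<delta> * dual_value \<phi> \<psi> y = 0"
      by (rule u_ode[OF solution y])
    show "y - \<rho> * y * ((y - \<phi> y) / (\<rho> * y)) \<in> {0<..\<phi>0}"
      using \<phi>_pos[OF solution y] \<phi>_le[OF solution y] y \<rho> by simp
  qed
  show ?thesis
    unfolding iff Let_def u
  proof (intro conjI allI impI ballI)
    obtain y0 \<phi> \<psi> where "solution y0 \<phi> \<psi>" using solution_exists by blast
    with solution_limit[OF this]
    show "\<exists>y0 \<phi> \<psi>. solution y0 \<phi> \<psi> \<and> ((\<exists>l>0. (\<phi> \<longlongrightarrow> l) (at_right 0)) \<or> (\<psi> \<longlongrightarrow> 1) (at_right 0))"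
      by blast
  qed (rule fb has_derivative_u has_derivative_deriv_u strict_antimono_u convex_on_u deriv_u_at_0; assumption)+
qed

end
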